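(* There exists an absolute constant $C>0$ such that the following holds. Let $d \geq 1$ be an integer, let $K \geq 2$ be a real number, and let $A \subseteq \mathbb{R}^d$ be a relatively dense set with $D^+(A-A) < K D^-(A)$. Then $A \subseteq M + F$, where $F \subseteq \mathbb{R}^d$ is a finite set and $M \subseteq \mathbb{R}^d$ is a cut-and-project set with at most $C (d + \log K)^7$ internal dimensions.
   Context: $\mathbb{R}^d$ is equipped with the supremum norm $\|\cdot\|_\infty$. For sets $A,B \subseteq \mathbb{R}^d$, $A+B = \{a+b : a\in A, b\in B\}$ and $A-B = \{a-b : a \in A, b \in B\}$. A set $A \subseteq \mathbb{R}^d$ is relatively dense if there is $R>0$ such that every closed ball of radius $R$ contains a point of $A$. The upper and lower uniform densities of $A \subseteq \mathbb{R}^d$ are $$D^+(A) = \limsup_{L\to\infty} \sup_{x \in \mathbb{R}^d} (2L)^{-d}\, |\{a \in A : \|a-x\|_\infty < L\}|,\qquad D^-(A) = \liminf_{L\to\infty} \inf_{x \in \mathbb{R}^d} (2L)^{-d}\, |\{a \in A : \|a-x\|_\infty < L\}|.$$ A cut-and-project set in $\mathbb{R}^d$ with $e$ internal dimensions ($e \geq 0$ an integer) is a set of the form $M = \pi_1(\Gamma \cap (\mathbb{R}^d \times \Omega))$, where $\pi_1 \colon \mathbb{R}^d \times \mathbb{R}^e \to \mathbb{R}^d$ is the projection onto the first coordinate, $\Gamma$ is a discrete subgroup of $\mathbb{R}^{d+e} = \mathbb{R}^d\times\mathbb{R}^e$, and $\Omega \subseteq \mathbb{R}^e$ is open and bounded.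 (No further conditions are imposed; in particular $\Gamma$ need not be a lattice.) *)

theory Defs
  imports "HOL-Analysis.Analysis" "HOL-Library.Function_Algebras"
begin

text \<open>
  The space \<open>\<real>\<^sup>n\<close> is \<^term>\<open>Euclidean_space n\<close> of the library, i.e. the functions \<open>nat \<Rightarrow> real\<close>
  vanishing at all indices \<open>i \<ge> n\<close>; this makes the dimension an ordinary natural number
  that can be quantified over. Vector addition is the pointwise one of
  \<^theory>\<open>HOL-Library.Function_Algebras\<close>, and the sum \<open>M + F\<close> of two sets is the one of
  \<^theory>\<open>HOL-Library.Set_Algebras\<close>.
\<close>

abbreviation Rn :: "nat \<Rightarrow> (nat \<Rightarrow> real) set" where
  "Rn n \<equiv> topspace (Euclidean_space n)"

text \<open>Inserting \<open>0\<close> only matters for \<open>n = 0\<close>, where the maximum would range over the empty set.\<close>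

definition sup_norm :: "nat \<Rightarrow> (nat \<Rightarrow> real) \<Rightarrow> real" where
  "sup_norm n x = Max (insert 0 ((\<lambda>i. \<bar>x i\<bar>) ` {..<n}))"

text \<open>The notation \<open>A - B\<close> already stands for the set-theoretic difference, hence a separate name.\<close>

definition minkowski_diff :: "(nat \<Rightarrow> real) set \<Rightarrow> (nat \<Rightarrow> real) set \<Rightarrow> (nat \<Rightarrow> real) set" where
  "minkowski_diff A B = {a - b | a b. a \<in> A \<and> b \<in> B}"

definition relatively_dense :: "nat \<Rightarrow> (nat \<Rightarrow> real) set \<Rightarrow> bool" where
  "relatively_dense d A \<longleftrightarrow> (\<exists>R>0. \<forall>x\<in>Rn d. \<exists>a\<in>A. sup_norm d (a - x) \<le> R)"

text \<open>
  Points are counted with the counting measure rather than with \<^const>\<open>card\<close>, so that an infinite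
  set has count \<open>\<infinity>\<close> (and not \<open>0\<close>); consequently densities are extended nonnegative reals.
\<close>

definition cube_density :: "nat \<Rightarrow> (nat \<Rightarrow> real) set \<Rightarrow> real \<Rightarrow> (nat \<Rightarrow> real) \<Rightarrow> ennreal" where
  "cube_density d A L x =
     emeasure (count_space UNIV) {a \<in> A. sup_norm d (a - x) < L} / ennreal ((2 * L) ^ d)"

definition upper_uniform_density :: "nat \<Rightarrow> (nat \<Rightarrow> real) set \<Rightarrow> ennreal" where
  "upper_uniform_density d A = Limsup at_top (\<lambda>L::real. SUP x\<in>Rn d. cube_density d A L x)"

definition lower_uniform_density :: "nat \<Rightarrow> (nat \<Rightarrow> real) set \<Rightarrow> ennreal" where
  "lower_uniform_density d A = Liminf at_top (\<lambda>L::real. INF x\<in>Rn d. cube_density d A L x)"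

text \<open>
  Points of \<open>\<real>\<^sup>d \<times> \<real>\<^sup>e\<close> are pairs, with componentwise addition and the product topology; discreteness
  of a subgroup means that its subspace topology is discrete.
\<close>

definition discrete_subgroup ::
    "nat \<Rightarrow> nat \<Rightarrow> ((nat \<Rightarrow> real) \<times> (nat \<Rightarrow> real)) set \<Rightarrow> bool" where
  "discrete_subgroup d e \<Gamma> \<longleftrightarrow>
     \<Gamma> \<subseteq> Rn d \<times> Rn e \<and>
     0 \<in> \<Gamma> \<and> (\<forall>x\<in>\<Gamma>. \<forall>y\<in>\<Gamma>. x + y \<in> \<Gamma>) \<and> (\<forall>x\<in>\<Gamma>. - x \<in> \<Gamma>) \<and>
     subtopology (prod_topology (Euclidean_space d) (Euclidean_space e)) \<Gamma> = discrete_topology \<Gamma>"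

definition cut_and_project_set :: "nat \<Rightarrow> nat \<Rightarrow> (nat \<Rightarrow> real) set \<Rightarrow> bool" where
  "cut_and_project_set d e M \<longleftrightarrow>
     (\<exists>\<Gamma> \<Omega>. discrete_subgroup d e \<Gamma> \<and>
            openin (Euclidean_space e) \<Omega> \<and> (\<exists>B. \<forall>y\<in>\<Omega>. sup_norm e y \<le> B) \<and>
            M = fst ` (\<Gamma> \<inter> (Rn d \<times> \<Omega>)))"

end

theory Submission
  imports Defs
begin

text \<open>
  The number of internal dimensions obtained is at most \<open>2 (d + log\<^sub>2 K) \<le> 3 (d + ln K)\<close>. Since \<open>F\<close> may be
  any finite set, constant factors can be lost freely, and the bound comes from comparing the exponential
  growth in \<open>k\<close> of two densities, both related to residue classes modulo \<open>2\<^sup>k\<close>.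

  Qualitatively, \<open>A\<close> is a Meyer set: \<open>A - A - A\<close> is locally finite (\<open>finite_small_triple_diffs\<close>).
  Choose a finitely generated group \<open>H = \<langle>h\<^sub>0, \<dots>, h\<^sub>r\<^sub>-\<^sub>1\<rangle>\<close> of least rank \<open>r\<close> such that finitely many
  cosets of \<open>H\<close> cover \<open>A\<close>. The coordinates \<open>z(a) \<in> \<int>\<^sup>r\<close> of the points of \<open>A\<close> are approximately
  additive, hence within bounded distance of a linear map \<open>\<ell>: \<real>\<^sup>d \<rightarrow> \<real>\<^sup>r\<close> (\<open>linear_coordinates\<close>).
  The discrete group of all \<open>(h, z(h) - \<ell>(h))\<close> with \<open>h \<in> H\<close>, together with a bounded window, then
  gives a cut-and-project set with \<open>r\<close> internal dimensions (\<open>covered_by_cut_and_project_set\<close>).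

  It remains to bound \<open>r\<close>. Let \<open>\<kappa> = 2\<^sup>d K\<close>, so that the sets \<open>A\<^sub>L\<close> of points of \<open>A\<close> in large cubes satisfy
  \<open>|A\<^sub>L - A\<^sub>L| \<le> \<kappa> |A\<^sub>L|\<close>. On the one hand, Petridis's lemma and the triangle inequality of Ruzsa give
  \<open>|X - 2\<^sup>k A\<^sub>L| \<le> \<kappa>\<^sup>2\<^sup>k\<^sup>+\<^sup>1 |X|\<close> for a large part \<open>X\<close> of \<open>A\<^sub>L\<close>. Hence \<open>X\<close> meets at most about \<open>\<kappa>\<^sup>2\<^sup>k\<close> classes
  modulo \<open>2\<^sup>k H\<close>, and one class contains a proportion of about \<open>\<kappa>\<^sup>-\<^sup>2\<^sup>k\<close> of \<open>A\<^sub>L\<close> (\<open>popular_residue_class\<close>).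
  On the other hand, this proportion is at most about \<open>2\<^sup>-\<^sup>k\<^sup>r\<close>. By minimality of \<open>r\<close>, the rows of
  \<open>\<ell>\<close> are independent over \<open>\<int>\<close>, so by Kronecker's theorem some line in \<open>\<ell>(\<real>\<^sup>d)\<close> passes close to points
  of all \<open>2\<^sup>k\<^sup>r\<close> residue classes of \<open>\<int>\<^sup>r\<close> modulo \<open>2\<^sup>k\<close>. Translating by such points spreads the part
  of \<open>A\<close> in one class to \<open>2\<^sup>k\<^sup>r\<close> disjoint sets that all lie within a bounded number of translates of
  \<open>A\<close>, a number that does not depend on \<open>k\<close> (\<open>translates_of_residue_class\<close>). All
  other factors being independent of \<open>k\<close>, the limit \<open>k \<rightarrow> \<infinity>\<close> gives \<open>2\<^sup>r \<le> \<kappa>\<^sup>2\<close> (\<open>rank_bound\<close>).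
\<close>

section \<open>The supremum norm\<close>

lemma sup_norm_le_iff: "sup_norm n x \<le> c \<longleftrightarrow> 0 \<le> c \<and> (\<forall>i<n. \<bar>x i\<bar> \<le> c)"
  unfolding sup_norm_def by (subst Max_le_iff) auto

lemma sup_norm_less_iff: "sup_norm n x < c \<longleftrightarrow> 0 < c \<and> (\<forall>i<n. \<bar>x i\<bar> < c)"
  unfolding sup_norm_def by (subst Max_less_iff) auto

lemma abs_le_sup_norm: "i < n \<Longrightarrow> \<bar>x i\<bar> \<le> sup_norm n x"
  using sup_norm_le_iff[of n x "sup_norm n x"] by auto

lemma sup_norm_nonneg: "0 \<le> sup_norm n x"
  using sup_norm_le_iff[of n x "sup_norm n x"] by auto

lemma sup_norm_triangle: "sup_norm n (x + y) \<le> sup_norm n x + sup_norm n y"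
  unfolding sup_norm_le_iff
  by (auto simp: sup_norm_nonneg intro: abs_triangle_ineq[THEN order_trans] add_mono abs_le_sup_norm)

lemma sup_norm_minus: "sup_norm n (- x) = sup_norm n x"
  by (simp add: sup_norm_def)

lemma sup_norm_minus_commute: "sup_norm n (x - y) = sup_norm n (y - x)"
  using sup_norm_minus[of n "y - x"] by (simp only: minus_diff_eq)

lemma sup_norm_triangle_diff: "sup_norm n (x - y) \<le> sup_norm n x + sup_norm n y"
  using sup_norm_triangle[of n x "- y"] by (simp add: sup_norm_minus)

lemma sup_norm_sum_le:
  assumes "z = x + y" "sup_norm n x \<le> a" "sup_norm n y \<le> b"
  shows "sup_norm n z \<le> a + b"
  using sup_norm_triangle[of n x y] assms by simp

lemma sup_norm_scale_le: "sup_norm n (\<lambda>i. c * x i) \<le> \<bar>c\<bar> * sup_norm n x"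
  unfolding sup_norm_le_iff
  by (auto simp: sup_norm_nonneg abs_mult intro!: mult_left_mono abs_le_sup_norm)

lemma Rn_iff: "x \<in> Rn n \<longleftrightarrow> (\<forall>i\<ge>n. x i = 0)"
  by (simp add: topspace_Euclidean_space)

lemma Rn_add: "x \<in> Rn n \<Longrightarrow> y \<in> Rn n \<Longrightarrow> x + y \<in> Rn n"
  and Rn_diff: "x \<in> Rn n \<Longrightarrow> y \<in> Rn n \<Longrightarrow> x - y \<in> Rn n"
  and Rn_zero: "0 \<in> Rn n"
  and Rn_scale: "x \<in> Rn n \<Longrightarrow> (\<lambda>i. c * x i) \<in> Rn n"
  by (auto simp: Rn_iff)

section \<open>Sumsets of sets with small doubling\<close>

text \<open>Subtraction of sets is written as addition of \<open>uminus ` B\<close>, so that the associativity and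
  commutativity of set addition apply to mixed sums and differences.\<close>

lemma card_translate: "card ((\<lambda>x. c + x) ` X) = card (X :: 'a::ab_group_add set)"
  by (rule card_image) (simp add: inj_on_def)

lemma card_uminus: "card (uminus ` X) = card (X :: 'a::ab_group_add set)"
  by (rule card_image) (simp add: inj_on_def)

lemma diff_mem: "a \<in> A \<Longrightarrow> b \<in> B \<Longrightarrow> a - b \<in> A + uminus ` (B :: 'a::ab_group_add set)"
  unfolding diff_conv_add_uminus by (intro set_plus_intro imageI)

lemma diff_memE:
  assumes "x \<in> A + uminus ` (B :: 'a::ab_group_add set)"
  obtains a b where "a \<in> A" "b \<in> B" "x = a - b"
  using assms that unfolding diff_conv_add_uminus by (auto elim!: set_plus_elim)

lemma insert_set_plus: "insert c C + X = (C + X) \<union> (\<lambda>x. c + x) ` (X :: 'a::ab_group_add set)"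
  by (auto simp: set_plus_def)

text \<open>
  Petridis's lemma, by letting the elements \<open>c\<close> enter \<open>C\<close> one at a time. Those \<open>x \<in> X\<close> for which
  \<open>c + x + B\<close> was present already form a subset \<open>Y\<close> of \<open>X\<close>, and the minimality of \<open>X\<close> says that
  \<open>Y + B\<close>, which contributes nothing new, is large.
\<close>

lemma petridis:
  fixes X B :: "'a::ab_group_add set"
  assumes "finite X" "finite B" "finite C"
    and minimal: "\<And>Y. Y \<subseteq> X \<Longrightarrow> card (X + B) * card Y \<le> card (Y + B) * card X"
  shows "card (C + (X + B)) * card X \<le> card (X + B) * card (C + X)"
  using \<open>finite C\<close>
proof (induction C rule: finite_induct)
  case empty
  then show ?case by (simp add: set_plus_def)
next
  case (insert c C)
  define Y where "Y = {x \<in> X. (\<lambda>b. c + x + b) ` B \<subseteq> C + (X + B)}"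
  have fin: "finite (X + B)" "finite (C + X)" "finite (C + (X + B))" "finite Y" "finite (Y + B)"
    using assms insert by (auto simp: Y_def intro!: finite_set_plus)
  have YX: "Y \<subseteq> X" by (auto simp: Y_def)
  then have YB: "Y + B \<subseteq> X + B" by (rule set_plus_mono2) simp
  have old: "(\<lambda>x. c + x) ` (Y + B) \<subseteq> C + (X + B)"
    by (auto simp: Y_def set_plus_def add.assoc)
  have "insert c C + (X + B) \<subseteq> (C + (X + B)) \<union> (\<lambda>x. c + x) ` ((X + B) - (Y + B))"
    unfolding insert_set_plus using old by blast
  then have "card (insert c C + (X + B)) \<le> card ((C + (X + B)) \<union> (\<lambda>x. c + x) ` ((X + B) - (Y + B)))"
    using fin by (intro card_mono) auto
  also have "\<dots> \<le> card (C + (X + B)) + card ((X + B) - (Y + B))"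
    using card_Un_le[of "C + (X + B)" "(\<lambda>x. c + x) ` ((X + B) - (Y + B))"]
    by (simp only: card_translate)
  also have "card ((X + B) - (Y + B)) = card (X + B) - card (Y + B)"
    using fin YB by (intro card_Diff_subset)
  finally have up: "card (insert c C + (X + B)) + card (Y + B) \<le> card (C + (X + B)) + card (X + B)"
    using card_mono[OF fin(1) YB] by linarith
  have "(C + X) \<union> (\<lambda>x. c + x) ` (X - Y) \<subseteq> insert c C + X"
    unfolding insert_set_plus by blast
  moreover have "(C + X) \<inter> (\<lambda>x. c + x) ` (X - Y) = {}"
  proof -
    have "x \<in> Y" if "x \<in> X" "c + x \<in> C + X" for x
      using that by (auto simp: Y_def add.assoc[symmetric] intro!: set_plus_intro)
    then show ?thesis by blast
  qed
  moreover have "finite (insert c C + X)" "finite ((\<lambda>x. c + x) ` (X - Y))"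
    using assms insert by (auto intro!: finite_set_plus)
  ultimately have "card (C + X) + card ((\<lambda>x. c + x) ` (X - Y)) \<le> card (insert c C + X)"
    using fin(2) by (metis card_Un_disjoint card_mono)
  then have "card (C + X) + card (X - Y) \<le> card (insert c C + X)"
    by (simp only: card_translate)
  moreover have "card (X - Y) + card Y = card X"
    using card_Diff_subset[OF fin(4) YX] card_mono[OF \<open>finite X\<close> YX] by simp
  ultimately have down: "card (C + X) + card X \<le> card (insert c C + X) + card Y" by linarith
  have "card (insert c C + (X + B)) * card X + card (Y + B) * card X
      \<le> card (C + (X + B)) * card X + card (X + B) * card X"
    using mult_le_mono1[OF up, of "card X"] by (simp only: add_mult_distrib)
  also have "\<dots> \<le> card (X + B) * (card (C + X) + card X)"
    using insert.IH by (simp only: add_mult_distrib2 add_le_cancel_right)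
  also have "\<dots> \<le> card (X + B) * (card (insert c C + X) + card Y)"
    using down by (rule mult_le_mono2)
  also have "\<dots> \<le> card (X + B) * card (insert c C + X) + card (Y + B) * card X"
    using minimal[OF YX] by (simp only: add_mult_distrib2 add_le_cancel_left)
  finally show ?case by linarith
qed

text \<open>Ruzsa's triangle inequality: fixing a representation \<open>a - c\<close> of each difference, the
  pair \<open>(a - c, b)\<close> can be recovered from \<open>(a - b, b - c)\<close>.\<close>

lemma ruzsa_triangle:
  fixes A B C :: "'a::ab_group_add set"
  assumes "finite A" "finite B" "finite C"
  shows "card (A + uminus ` C) * card B \<le> card (A + uminus ` B) * card (B + uminus ` C)"
proof -
  have "\<forall>d\<in>A + uminus ` C. \<exists>p. fst p \<in> A \<and> snd p \<in> C \<and> d = fst p - snd p"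
  proof
    fix d assume "d \<in> A + uminus ` C"
    then obtain a c where "a \<in> A" "c \<in> C" "d = a - c" by (rule diff_memE)
    then show "\<exists>p. fst p \<in> A \<and> snd p \<in> C \<and> d = fst p - snd p"
      by (intro exI[of _ "(a, c)"]) simp
  qed
  then obtain p where p: "\<And>d. d \<in> A + uminus ` C \<Longrightarrow> fst (p d) \<in> A \<and> snd (p d) \<in> C \<and> d = fst (p d) - snd (p d)"
    by metis
  let ?g = "\<lambda>(d, b). (fst (p d) - b, b - snd (p d))"
  have "inj_on ?g ((A + uminus ` C) \<times> B)"
  proof (rule inj_onI, clarsimp)
    fix d b d' b'
    assume d: "d \<in> A + uminus ` C" "d' \<in> A + uminus ` C"
      and eq: "fst (p d) - b = fst (p d') - b'" "b - snd (p d) = b' - snd (p d')"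
    have "d = (fst (p d) - b) + (b - snd (p d))" using p[OF d(1)] by simp
    also have "\<dots> = d'" unfolding eq using p[OF d(2)] by simp
    finally show "d = d' \<and> b = b'" using eq by auto
  qed
  moreover have "?g ` ((A + uminus ` C) \<times> B) \<subseteq> (A + uminus ` B) \<times> (B + uminus ` C)"
    using p by (auto simp del: diff_conv_add_uminus intro!: diff_mem)
  ultimately have "card ((A + uminus ` C) \<times> B) \<le> card ((A + uminus ` B) \<times> (B + uminus ` C))"
    using assms by (intro card_inj_on_le) (auto intro!: finite_set_plus)
  then show ?thesis by (simp add: card_cartesian_product)
qed

text \<open>
  For \<open>X\<close> of least relative growth, Petridis's lemma bounds \<open>X - A - A\<close>, which contains \<open>X - 2 A\<close>.
  From there \<open>X - 2\<^sup>k A\<close> is reached by \<open>k\<close> applications of the triangle inequality, with the dilates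
  \<open>2\<^sup>j X\<close> as middle sets. Thus the bound is exponential in \<open>k\<close> only, although elements of \<open>2\<^sup>k A\<close>
  are sums of \<open>2\<^sup>k\<close> elements of \<open>A\<close>.
\<close>

theorem card_diff_dyadic_dilate:
  fixes A :: "'a::ab_group_add set" and \<kappa> :: real
  assumes "finite A" "A \<noteq> {}"
    and doubling: "card (A + uminus ` A) \<le> \<kappa> * card A"
    and inj: "inj (\<lambda>x::'a. x + x)"
  obtains X where "X \<subseteq> A" "X \<noteq> {}" "card A \<le> \<kappa> * card X"
    "\<And>k. card (X + uminus ` (((\<lambda>x. x + x) ^^ k) ` A)) \<le> \<kappa> ^ (2 * k + 1) * card X"
proof -
  let ?B = "uminus ` A"
  define ratio where "ratio X = real (card (X + ?B)) / real (card X)" for X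
  define X where "X = arg_min_on ratio (Pow A - {{}})"
  have cand: "finite (Pow A - {{}})" "Pow A - {{}} \<noteq> {}" using assms(1,2) by auto
  have X: "X \<in> Pow A - {{}}" unfolding X_def by (rule arg_min_if_finite(1)[OF cand])
  have Xmin: "ratio X \<le> ratio Y" if "Y \<in> Pow A - {{}}" for Y
    unfolding X_def using arg_min_least[OF cand that] .
  have finX: "finite X" and X0: "card X > 0"
    using X assms(1) by (auto intro: finite_subset simp: card_gt_0_iff)
  have A0: "card A > 0" using assms by (simp add: card_gt_0_iff)
  have "ratio X \<le> ratio A" using Xmin assms by auto
  also have "\<dots> \<le> \<kappa>" using doubling A0 by (simp add: ratio_def field_simps)
  finally have XB: "card (X + ?B) \<le> \<kappa> * card X"
    using X0 by (simp add: ratio_def field_simps)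
  then have "\<kappa> \<ge> 0" using X0
    by (smt (verit) mult_less_0_iff of_nat_0_less_iff of_nat_0_le_iff)
  have minimal: "card (X + ?B) * card Y \<le> card (Y + ?B) * card X" if "Y \<subseteq> X" for Y
  proof (cases "Y = {}")
    case False
    then have "card Y > 0" using that finX by (auto simp: card_gt_0_iff intro: finite_subset)
    moreover have "ratio X \<le> ratio Y" using Xmin[of Y] False that X by auto
    ultimately have "real (card (X + ?B) * card Y) \<le> real (card (Y + ?B) * card X)"
      using X0 by (simp add: ratio_def field_simps)
    then show ?thesis by linarith
  qed simp
  have AX: "card A \<le> \<kappa> * card X"
  proof -
    obtain x where "x \<in> X" using X by auto
    then have "(\<lambda>y. x + y) ` ?B \<subseteq> X + ?B" by (auto intro!: set_plus_intro)
    then have "card A \<le> card (X + ?B)"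
      using card_mono[OF finite_set_plus[OF finX]] assms(1) card_translate card_uminus
      by (metis finite_imageI)
    then show ?thesis using XB by linarith
  qed
  let ?D = "\<lambda>k. ((\<lambda>x::'a. x + x) ^^ k)"
  have Dadd: "?D k (x - y) = ?D k x - ?D k y" for k x y by (induction k) auto
  have Dinj: "inj (?D k)" for k by (rule inj_fn[OF inj])
  have cardD: "card (?D k ` S) = card S" for k S
    by (rule card_image[OF inj_on_subset[OF Dinj subset_UNIV]])
  have step: "card (X + uminus ` (?D 1 ` A)) \<le> \<kappa> ^ 2 * card X"
  proof -
    have "card (X + uminus ` (?D 1 ` A)) \<le> card (?B + (X + ?B))"
    proof (rule card_mono)
      show "finite (?B + (X + ?B))" using finX assms(1) by (intro finite_set_plus) auto
      show "X + uminus ` (?D 1 ` A) \<subseteq> ?B + (X + ?B)"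
      proof
        fix u assume "u \<in> X + uminus ` (?D 1 ` A)"
        then obtain x a where xa: "x \<in> X" "a \<in> A" and "u = x - (a + a)"
          by (auto elim!: diff_memE)
        then have u: "u = (- a) + (x + (- a))" by (simp add: algebra_simps)
        show "u \<in> ?B + (X + ?B)" unfolding u using xa by (intro set_plus_intro imageI)
      qed
    qed
    then have "real (card (X + uminus ` (?D 1 ` A))) * card X \<le> real (card (?B + (X + ?B)) * card X)"
      by (simp add: mult_right_mono)
    also have "\<dots> \<le> real (card (X + ?B) * card (?B + X))"
      using petridis[OF finX _ _ minimal, of ?B] assms(1) by (intro of_nat_mono) simp
    also have "\<dots> = real (card (X + ?B)) ^ 2" by (simp add: add.commute power2_eq_square)
    also have "\<dots> \<le> (\<kappa> * card X) ^ 2" using XB by (intro power_mono) auto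
    finally show ?thesis using X0 by (simp add: power2_eq_square)
  qed
  have "card (X + uminus ` (?D k ` A)) \<le> \<kappa> ^ (2 * k + 1) * card X" for k
  proof (induction k)
    case 0
    then show ?case using XB by simp
  next
    case (Suc k)
    have "?D k ` X + uminus ` (?D (Suc k) ` A) = ?D k ` (X + uminus ` (?D 1 ` A))"
    proof -
      have D: "?D (Suc k) a = ?D k (?D 1 a)" for a
        by (simp only: Suc_eq_plus1 funpow_add comp_apply)
      show ?thesis
      proof (intro subset_antisym subsetI)
        fix u assume "u \<in> ?D k ` X + uminus ` (?D (Suc k) ` A)"
        then obtain x a where xa: "x \<in> X" "a \<in> A" and u: "u = ?D k x - ?D (Suc k) a"
          by (auto elim!: diff_memE)
        have "u = ?D k (x - ?D 1 a)" unfolding u Dadd D ..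
        then show "u \<in> ?D k ` (X + uminus ` (?D 1 ` A))"
          using xa by (intro image_eqI[of _ _ "x - ?D 1 a"] diff_mem imageI)
      next
        fix u assume "u \<in> ?D k ` (X + uminus ` (?D 1 ` A))"
        then obtain v where v: "v \<in> X + uminus ` (?D 1 ` A)" and u: "u = ?D k v" by blast
        from v obtain x b where x: "x \<in> X" and b: "b \<in> ?D 1 ` A" and vx: "v = x - b"
          by (rule diff_memE)
        from b obtain a where a: "a \<in> A" and ba: "b = ?D 1 a" by blast
        have "u = ?D k x - ?D (Suc k) a" unfolding u vx ba Dadd D ..
        then show "u \<in> ?D k ` X + uminus ` (?D (Suc k) ` A)"
          using x a by (simp only: diff_mem imageI)
      qed
    qed
    then have "card (?D k ` X + uminus ` (?D (Suc k) ` A)) = card (X + uminus ` (?D 1 ` A))"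
      by (simp only: cardD)
    moreover have "card (?D k ` X) = card X" by (rule cardD)
    ultimately have "card (X + uminus ` (?D (Suc k) ` A)) * card X
       \<le> card (X + uminus ` (?D k ` X)) * card (X + uminus ` (?D 1 ` A))"
      using ruzsa_triangle[of X "?D k ` X" "?D (Suc k) ` A", OF finX finite_imageI[OF finX] finite_imageI[OF assms(1)]]
      by (simp only:)
    also have "\<dots> \<le> card (X + uminus ` (?D k ` A)) * card (X + uminus ` (?D 1 ` A))"
      using X finX assms(1)
      by (intro mult_le_mono1 card_mono finite_set_plus finite_imageI set_plus_mono2 image_mono) auto
    finally have "real (card (X + uminus ` (?D (Suc k) ` A))) * card X
       \<le> real (card (X + uminus ` (?D k ` A))) * card (X + uminus ` (?D 1 ` A))"
      by (simp only: of_nat_mult[symmetric] of_nat_le_iff)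
    also have "\<dots> \<le> (\<kappa> ^ (2 * k + 1) * card X) * (\<kappa> ^ 2 * card X)"
      using Suc step \<open>\<kappa> \<ge> 0\<close> by (intro mult_mono) auto
    also have "\<dots> = (\<kappa> ^ (2 * Suc k + 1) * card X) * card X"
      by (simp add: power2_eq_square)
    finally show ?case using X0 by (simp only: mult_le_cancel_right_pos of_nat_0_less_iff)
  qed
  then show ?thesis using that X AX by blast
qed

section \<open>Approximately additive functions\<close>

text \<open>Hyers's theorem. The functions \<open>x \<mapsto> f (2\<^sup>n x) / 2\<^sup>n \<plusminus> E / 2\<^sup>n\<close> squeeze the additive function,
  the lower ones being increasing and the upper ones decreasing in \<open>n\<close>.\<close>

lemma hyers:
  fixes f :: "'a::ab_group_add \<Rightarrow> real"
  assumes closed: "\<And>x y. x \<in> S \<Longrightarrow> y \<in> S \<Longrightarrow> x + y \<in> S"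
    and quasi: "\<And>x y. x \<in> S \<Longrightarrow> y \<in> S \<Longrightarrow> \<bar>f (x + y) - f x - f y\<bar> \<le> E"
  obtains g where "\<And>x y. x \<in> S \<Longrightarrow> y \<in> S \<Longrightarrow> g (x + y) = g x + g y"
    "\<And>x. x \<in> S \<Longrightarrow> \<bar>g x - f x\<bar> \<le> E"
proof -
  define D where "D n x = ((\<lambda>x::'a. x + x) ^^ n) x" for n x
  define s where "s x n = f (D n x) / 2 ^ n" for x n
  define e where "e n = E / 2 ^ n" for n :: nat
  have DS: "D n x \<in> S" if "x \<in> S" for n x
    using that closed by (induction n) (auto simp: D_def)
  have Dadd: "D n (x + y) = D n x + D n y" for n x y
    by (induction n) (auto simp: D_def algebra_simps)
  have e_Suc: "e n = 2 * e (Suc n)" for n by (simp add: e_def)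
  have step: "\<bar>s x (Suc n) - s x n\<bar> \<le> e (Suc n)" if "x \<in> S" for x n
  proof -
    have "s x (Suc n) - s x n = (f (D n x + D n x) - f (D n x) - f (D n x)) / 2 ^ Suc n"
      by (simp add: s_def D_def field_simps)
    also have "\<bar>\<dots>\<bar> \<le> E / 2 ^ Suc n"
      using quasi[OF DS[OF that] DS[OF that], of n n]
      by (simp only: abs_divide) (simp add: divide_right_mono)
    finally show ?thesis by (simp add: e_def)
  qed
  have e0: "e \<longlonglongrightarrow> 0"
    unfolding e_def by (rule LIMSEQ_divide_realpow_zero) simp
  have lim: "\<exists>l. s x \<longlonglongrightarrow> l \<and> \<bar>l - f x\<bar> \<le> E" if x: "x \<in> S" for x
  proof -
    have inc: "incseq (\<lambda>n. s x n - e n)"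
      using step[OF x] e_Suc by (intro incseq_SucI) (smt (verit))
    have dec: "decseq (\<lambda>n. s x n + e n)"
      using step[OF x] e_Suc by (intro decseq_SucI) (smt (verit))
    have e_nonneg: "e n \<ge> 0" for n
      using quasi[OF x x] by (simp add: e_def)
    have "s x n - e n \<le> s x 0 + e 0" for n
      using decseqD[OF dec, of 0 n] e_nonneg[of n] by simp
    then obtain l where l: "(\<lambda>n. s x n - e n) \<longlonglongrightarrow> l"
      using incseq_convergent[OF inc] by blast
    have sl: "s x \<longlonglongrightarrow> l" using tendsto_add[OF l e0] by simp
    have "s x 0 - e 0 \<le> l" using incseq_le[OF inc l] .
    moreover have "(\<lambda>n. s x n + e n) \<longlonglongrightarrow> l" using tendsto_add[OF sl e0] by simp
    from decseq_ge[OF dec this] have "l \<le> s x 0 + e 0" .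
    ultimately have "\<bar>l - f x\<bar> \<le> E" by (simp add: s_def e_def D_def)
    with sl show ?thesis by blast
  qed
  then obtain g where g: "\<And>x. x \<in> S \<Longrightarrow> s x \<longlonglongrightarrow> g x" "\<And>x. x \<in> S \<Longrightarrow> \<bar>g x - f x\<bar> \<le> E"
    by metis
  have "g (x + y) = g x + g y" if "x \<in> S" "y \<in> S" for x y
  proof -
    have "\<bar>s (x + y) n - s x n - s y n\<bar> \<le> e n" for n
    proof -
      have "s (x + y) n - s x n - s y n = (f (D n x + D n y) - f (D n x) - f (D n y)) / 2 ^ n"
        by (simp add: s_def Dadd field_simps)
      then show ?thesis
        using quasi[OF DS[OF that(1)] DS[OF that(2)], of n n] by (simp add: e_def divide_right_mono)
    qed
    then have "(\<lambda>n. s (x + y) n - s x n - s y n) \<longlonglongrightarrow> 0"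
      using e0 by (intro Lim_null_comparison[OF always_eventually e0]) simp
    moreover have "(\<lambda>n. s (x + y) n - s x n - s y n) \<longlonglongrightarrow> g (x + y) - g x - g y"
      using that closed by (intro tendsto_diff g)
    ultimately show ?thesis using LIMSEQ_unique by fastforce
  qed
  then show ?thesis using g that by blast
qed

text \<open>The deviation of \<open>\<phi>\<close> from linearity is additive and vanishes at the integers. So it is periodic,
  hence bounded on the whole line, and a bounded additive function is zero.\<close>

lemma additive_bounded_imp_linear:
  fixes \<phi> :: "real \<Rightarrow> real"
  assumes add: "\<And>s t. \<phi> (s + t) = \<phi> s + \<phi> t"
    and bounded: "\<And>t. 0 \<le> t \<Longrightarrow> t \<le> 1 \<Longrightarrow> \<bar>\<phi> t\<bar> \<le> M"
  shows "\<phi> t = t * \<phi> 1"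
proof -
  define \<psi> where "\<psi> t = \<phi> t - t * \<phi> 1" for t
  have \<psi>_add: "\<psi> (s + t) = \<psi> s + \<psi> t" for s t
    by (simp add: \<psi>_def add algebra_simps)
  have \<psi>0: "\<psi> 0 = 0" using \<psi>_add[of 0 0] by simp
  have \<psi>_nat: "\<psi> (of_nat n * t) = of_nat n * \<psi> t" for n t
    by (induction n) (auto simp: \<psi>0 \<psi>_add algebra_simps)
  have \<psi>1: "\<psi> 1 = 0" by (simp add: \<psi>_def)
  have \<psi>_int: "\<psi> (of_int k) = 0" for k
  proof (cases k)
    case (nonneg n)
    then show ?thesis using \<psi>_nat[of n 1] \<psi>1 by simp
  next
    case (neg n)
    then show ?thesis
      using \<psi>_nat[of "Suc n" 1] \<psi>1 \<psi>0 \<psi>_add[of "of_int k" "of_nat (Suc n)"] by simp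
  qed
  have \<psi>_bound: "\<bar>\<psi> t\<bar> \<le> 2 * M" for t
  proof -
    have "\<psi> t = \<psi> (frac t)"
      using \<psi>_add[of "of_int \<lfloor>t\<rfloor>" "frac t"] \<psi>_int by (simp add: frac_def)
    moreover have "\<bar>\<psi> s\<bar> \<le> 2 * M" if "0 \<le> s" "s \<le> 1" for s
    proof -
      have "\<bar>s * \<phi> 1\<bar> \<le> 1 * M"
        unfolding abs_mult using that bounded[of 1] by (intro mult_mono) auto
      then show ?thesis using bounded[OF that] by (auto simp: \<psi>_def)
    qed
    ultimately show ?thesis using frac_ge_0[of t] frac_lt_1[of t] by auto
  qed
  have "\<psi> t = 0"
  proof (rule ccontr)
    assume "\<psi> t \<noteq> 0"
    then obtain n :: nat where "2 * M < of_nat n * \<bar>\<psi> t\<bar>"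
      using reals_Archimedean3[of "\<bar>\<psi> t\<bar>"] by auto
    then show False using \<psi>_bound[of "of_nat n * t"] by (simp add: \<psi>_nat abs_mult)
  qed
  then show ?thesis by (simp add: \<psi>_def)
qed

lemma additive_bounded_on_Rn:
  fixes g :: "(nat \<Rightarrow> real) \<Rightarrow> real"
  assumes add: "\<And>x y. x \<in> Rn d \<Longrightarrow> y \<in> Rn d \<Longrightarrow> g (x + y) = g x + g y"
    and bounded: "\<And>x. x \<in> Rn d \<Longrightarrow> sup_norm d x \<le> 1 \<Longrightarrow> \<bar>g x\<bar> \<le> M"
  obtains u where "\<And>x. x \<in> Rn d \<Longrightarrow> g x = (\<Sum>j<d. u j * x j)"
proof -
  define E where "E j t = (\<lambda>i. if i = j then t else 0)" for j :: nat and t :: real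
  have E_Rn: "E j t \<in> Rn d" if "j < d" for j t using that by (auto simp: E_def Rn_iff)
  have lin: "g (E j t) = t * g (E j 1)" if "j < d" for j t
  proof (rule additive_bounded_imp_linear)
    fix s t
    have "E j (s + t) = E j s + E j t" by (auto simp: E_def)
    then show "g (E j (s + t)) = g (E j s) + g (E j t)" using add E_Rn that by metis
  next
    fix t :: real assume "0 \<le> t" "t \<le> 1"
    then have "sup_norm d (E j t) \<le> 1" by (simp add: sup_norm_le_iff E_def)
    then show "\<bar>g (E j t)\<bar> \<le> M" using bounded E_Rn that by blast
  qed
  have g0: "g 0 = 0" using add[OF Rn_zero Rn_zero] by simp
  have trunc: "g (\<lambda>i. if i < m then x i else 0) = (\<Sum>j<m. g (E j 1) * x j)"
    if "x \<in> Rn d" "m \<le> d" for x m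
    using that(2)
  proof (induction m)
    case 0
    then show ?case using g0 by (simp add: zero_fun_def)
  next
    case (Suc m)
    have "(\<lambda>i. if i < Suc m then x i else 0) = (\<lambda>i. if i < m then x i else 0) + E m (x m)"
      by (auto simp: E_def fun_eq_iff less_Suc_eq)
    moreover have "(\<lambda>i. if i < m then x i else 0) \<in> Rn d" using Suc.prems by (auto simp: Rn_iff)
    moreover have "E m (x m) \<in> Rn d" using Suc.prems by (intro E_Rn) simp
    ultimately have "g (\<lambda>i. if i < Suc m then x i else 0)
        = g (\<lambda>i. if i < m then x i else 0) + g (E m (x m))"
      by (simp only: add)
    also have "\<dots> = (\<Sum>j<m. g (E j 1) * x j) + g (E m 1) * x m"
      using Suc.IH lin[of m "x m"] Suc.prems by (simp add: mult.commute)
    finally show ?case by simp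
  qed
  have "g x = (\<Sum>j<d. g (E j 1) * x j)" if "x \<in> Rn d" for x
  proof -
    have "(\<lambda>i. if i < d then x i else 0) = x" using that by (auto simp: Rn_iff fun_eq_iff)
    then show ?thesis using trunc[OF that, of d] by simp
  qed
  then show ?thesis using that[of "\<lambda>j. g (E j 1)"] by blast
qed

section \<open>Relatively dense sets with locally finite difference sets\<close>

text \<open>The last assumption is the form in which finite upper density of \<open>A - A\<close> is used. That \<open>N\<close> is
  uniform in \<open>x\<close> is essential for the Meyer property below.\<close>

locale meyer_set =
  fixes d :: nat and A :: "(nat \<Rightarrow> real) set" and R :: real
  assumes subset_Rn: "A \<subseteq> Rn d"
    and R_pos: "R > 0"
    and dense: "x \<in> Rn d \<Longrightarrow> \<exists>a\<in>A. sup_norm d (a - x) \<le> R"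
    and diff_count: "\<exists>N. \<forall>x\<in>Rn d. finite {u \<in> minkowski_diff A A. sup_norm d (u - x) \<le> \<rho>} \<and>
                       card {u \<in> minkowski_diff A A. sup_norm d (u - x) \<le> \<rho>} \<le> N"
begin

definition small_diffs :: "real \<Rightarrow> (nat \<Rightarrow> real) set" where
  "small_diffs \<rho> = {u \<in> minkowski_diff A A. sup_norm d u \<le> \<rho>}"

lemma finite_small_diffs: "finite (small_diffs \<rho>)"
  using diff_count[of \<rho>] Rn_zero by (force simp: small_diffs_def)

lemma small_diffsI: "a \<in> A \<Longrightarrow> b \<in> A \<Longrightarrow> sup_norm d (a - b) \<le> \<rho> \<Longrightarrow> a - b \<in> small_diffs \<rho>"
  by (auto simp: small_diffs_def minkowski_diff_def)

lemma in_Rn: "a \<in> A \<Longrightarrow> a \<in> Rn d"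
  using subset_Rn by blast

lemma nonempty: "A \<noteq> {}"
  using dense[OF Rn_zero] by auto

lemma finite_ball: "finite {a \<in> A. sup_norm d a \<le> \<rho>}"
proof -
  obtain b where b: "b \<in> A" using nonempty by auto
  have "{a \<in> A. sup_norm d a \<le> \<rho>} \<subseteq> (\<lambda>u. u + b) ` small_diffs (\<rho> + sup_norm d b)"
  proof safe
    fix a assume "a \<in> A" "sup_norm d a \<le> \<rho>"
    then have "a - b \<in> small_diffs (\<rho> + sup_norm d b)"
      using b sup_norm_triangle_diff[of d a b] by (intro small_diffsI) auto
    then show "a \<in> (\<lambda>u. u + b) ` small_diffs (\<rho> + sup_norm d b)" by (rule rev_image_eqI) simp
  qed
  then show ?thesis using finite_small_diffs finite_surj by blast
qed

text \<open>Any point of \<open>A\<close> is joined to any other by a chain of points of \<open>A\<close> that follows the segment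
  between them. Hence a property spreads over \<open>A\<close> as soon as it passes to points at distance
  at most \<open>3R\<close>: a step of length \<open>2R\<close> along the segment, corrected by \<open>R\<close> at either end.\<close>

lemma chain_induct [consumes 2, case_names base step]:
  assumes "a \<in> A" "b \<in> A" "P b"
    and step: "\<And>a a'. a \<in> A \<Longrightarrow> a' \<in> A \<Longrightarrow> sup_norm d (a - a') \<le> 3 * R \<Longrightarrow> P a' \<Longrightarrow> P a"
  shows "P a"
proof -
  have "sup_norm d (a - b) \<le> of_nat n * R \<Longrightarrow> a \<in> A \<Longrightarrow> P a" for n a
  proof (induction n arbitrary: a)
    case 0
    then have "sup_norm d (a - b) \<le> 3 * R" using R_pos by linarith
    then show ?case using step 0 assms by blast
  next
    case (Suc n)
    define s where "s = sup_norm d (a - b)"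
    show ?case
    proof (cases "s \<le> 3 * R")
      case True
      then show ?thesis using step assms Suc.prems unfolding s_def by blast
    next
      case False
      define c where "c = 2 * R / s"
      have c: "0 \<le> c" "c \<le> 1" "c * s = 2 * R"
        using False R_pos by (auto simp: c_def)
      define x where "x = b + (\<lambda>i. (1 - c) * (a - b) i)"
      have "x \<in> Rn d" using assms Suc in_Rn
        by (auto simp: x_def intro!: Rn_add Rn_scale Rn_diff simp del: minus_apply)
      then obtain a' where a': "a' \<in> A" "sup_norm d (a' - x) \<le> R" using dense by blast
      have "sup_norm d (\<lambda>i. (1 - c) * (a - b) i) \<le> (1 - c) * s"
        using sup_norm_scale_le[of d "1 - c" "a - b"] c by (simp add: s_def)
      then have "sup_norm d (a' - b) \<le> R + (1 - c) * s"
        by (intro sup_norm_sum_le[OF _ a'(2)]) (auto simp: x_def)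
      also have "\<dots> = s - R" using c by (simp add: algebra_simps)
      also have "\<dots> \<le> of_nat n * R" 
        using Suc.prems(1) unfolding s_def of_nat_Suc distrib_right by linarith
      finally have "P a'" using Suc.IH a' by blast
      have "sup_norm d (\<lambda>i. c * (a - b) i) \<le> 2 * R"
        using sup_norm_scale_le[of d c "a - b"] c by (simp add: s_def)
      moreover have "sup_norm d (x - a') \<le> R"
        using a'(2) by (simp only: sup_norm_minus_commute[of d x a'])
      moreover have "a - a' = (x - a') + (\<lambda>i. c * (a - b) i)"
        by (auto simp: x_def fun_eq_iff algebra_simps)
      ultimately have "sup_norm d (a - a') \<le> R + 2 * R"
        using sup_norm_sum_le by blast
      then show ?thesis using step[OF Suc.prems(2) a'(1)] \<open>P a'\<close> by simp
    qed
  qed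
  moreover obtain n :: nat where "sup_norm d (a - b) \<le> of_nat n * R"
    using reals_Archimedean3[OF R_pos] by (meson less_imp_le)
  ultimately show ?thesis using assms by blast
qed

text \<open>
  The Meyer property. For fixed \<open>c\<close>, the elements of \<open>A - A - c\<close> of norm at most \<open>\<rho>\<close> are few, with
  a bound \<open>N\<close> that does not depend on \<open>c\<close>. Let \<open>a - b - c\<close> be one of them. Moving \<open>b\<close> along a
  chain to a fixed point \<open>b\<^sub>0\<close>, and letting \<open>a\<close> follow, joins it inside this small set to an element
  \<open>a' - b\<^sub>0 - c\<close>, where \<open>a' - c\<close> is bounded and so has only finitely many possible values. All steps
  on the way are taken from a fixed finite set, and at most \<open>N\<^sup>2\<close> of them are needed.
\<close>

proposition finite_small_triple_diffs:
  "finite {w. \<exists>a\<in>A. \<exists>b\<in>A. \<exists>c\<in>A. w = a - b - c \<and> sup_norm d w \<le> \<rho>}"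
proof -
  have main: "finite {w. \<exists>a\<in>A. \<exists>b\<in>A. \<exists>c\<in>A. w = a - b - c \<and> sup_norm d w \<le> \<rho>}" if "\<rho> \<ge> R" for \<rho>
  proof -
    obtain b0 where b0: "b0 \<in> A" using nonempty by auto
    define Base where "Base = (\<lambda>u. u - b0) ` small_diffs (\<rho> + sup_norm d b0)"
    define \<Psi> where "\<Psi> = (\<lambda>(p, q). p - q) ` (small_diffs (\<rho> + R + 3 * R) \<times> small_diffs (3 * R))"
    have fin: "finite Base" "finite \<Psi>"
      by (auto simp: Base_def \<Psi>_def finite_small_diffs)
    obtain N where N: "\<And>x. x \<in> Rn d \<Longrightarrow> finite {u \<in> minkowski_diff A A. sup_norm d (u - x) \<le> \<rho>}"
        "\<And>x. x \<in> Rn d \<Longrightarrow> card {u \<in> minkowski_diff A A. sup_norm d (u - x) \<le> \<rho>} \<le> N"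
      using diff_count[of \<rho>] by blast
    define W where "W c = {w. \<exists>a\<in>A. \<exists>b\<in>A. w = a - b - c \<and> sup_norm d w \<le> \<rho>}" for c
    have W_sub: "W c \<subseteq> (\<lambda>u. u - c) ` {u \<in> minkowski_diff A A. sup_norm d (u - c) \<le> \<rho>}" for c
      by (auto simp: W_def minkowski_diff_def)
    have W_fin: "finite (W c)" and W_card: "card (W c) \<le> N" if "c \<in> A" for c
    proof -
      show "finite (W c)" using W_sub[of c] N(1)[OF in_Rn[OF that]] finite_surj by blast
      have "card (W c) \<le> card {u \<in> minkowski_diff A A. sup_norm d (u - c) \<le> \<rho>}"
        using W_sub[of c] N(1)[OF in_Rn[OF that]] by (rule surj_card_le[rotated])
      then show "card (W c) \<le> N" using N(2)[OF in_Rn[OF that]] by linarith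
    qed
    define r where "r c = {(v, w). v \<in> W c \<and> w \<in> W c \<and> w - v \<in> \<Psi>}" for c
    have r_fin: "finite (r c)" and r_card: "card (r c) \<le> N * N" if "c \<in> A" for c
    proof -
      have sub: "r c \<subseteq> W c \<times> W c" by (auto simp: r_def)
      show "finite (r c)" using sub W_fin[OF that] by (meson finite_SigmaI finite_subset)
      have "card (r c) \<le> card (W c) * card (W c)"
        using card_mono[OF _ sub] W_fin[OF that] by (simp add: card_cartesian_product)
      also have "\<dots> \<le> N * N" using W_card[OF that] by (intro mult_le_mono)
      finally show "card (r c) \<le> N * N" .
    qed
    have reach: "\<forall>a\<in>A. sup_norm d (a - b - c) \<le> \<rho> \<longrightarrow> (\<exists>v\<in>Base. (v, a - b - c) \<in> (r c)\<^sup>*)"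
      if c: "c \<in> A" and "b \<in> A" for b c
      using \<open>b \<in> A\<close> b0
    proof (induction rule: chain_induct)
      case base
      show ?case
      proof (intro ballI impI)
        fix a assume a: "a \<in> A" "sup_norm d (a - b0 - c) \<le> \<rho>"
        then have "sup_norm d (a - c) \<le> \<rho> + sup_norm d b0"
          by (intro sup_norm_sum_le[OF _ a(2)]) auto
        then have "a - c \<in> small_diffs (\<rho> + sup_norm d b0)"
          using a c by (intro small_diffsI)
        then have "a - b0 - c \<in> Base"
          unfolding Base_def by (rule rev_image_eqI) (simp add: algebra_simps)
        then show "\<exists>v\<in>Base. (v, a - b0 - c) \<in> (r c)\<^sup>*" by blast
      qed
    next
      case (step b b')
      show ?case
      proof (intro ballI impI)
        fix a assume a: "a \<in> A" "sup_norm d (a - b - c) \<le> \<rho>"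
        obtain a' where a': "a' \<in> A" "sup_norm d (a' - (b' + c)) \<le> R"
          using dense[OF Rn_add, OF in_Rn in_Rn, OF step(2) c] by blast
        have eq: "a' - (b' + c) = a' - b' - c" by (simp add: algebra_simps)
        have a'\<rho>: "sup_norm d (a' - b' - c) \<le> \<rho>" using a'(2) \<open>\<rho> \<ge> R\<close> unfolding eq by linarith
        then obtain v where v: "v \<in> Base" "(v, a' - b' - c) \<in> (r c)\<^sup>*" using step a' by blast
        have "sup_norm d ((a - b - c) - (a' - b' - c)) \<le> \<rho> + R"
          using sup_norm_triangle_diff[of d "a - b - c" "a' - b' - c"] a(2) a'(2) eq by simp
        then have "sup_norm d (a - a') \<le> \<rho> + R + 3 * R"
          by (rule sup_norm_sum_le[rotated, OF _ step(3)]) (simp add: algebra_simps)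
        then have "a - a' \<in> small_diffs (\<rho> + R + 3 * R)" using a a' by (intro small_diffsI)
        moreover have "b - b' \<in> small_diffs (3 * R)" using step by (intro small_diffsI)
        ultimately have "(a - a') - (b - b') \<in> \<Psi>" unfolding \<Psi>_def by force
        moreover have diff_step: "(a - b - c) - (a' - b' - c) = (a - a') - (b - b')" by simp
        ultimately have "(a' - b' - c, a - b - c) \<in> r c"
          unfolding r_def W_def using a a'(1) a'\<rho> step(1,2) by (auto simp only: mem_Collect_eq case_prod_conv diff_step)
        then show "\<exists>v\<in>Base. (v, a - b - c) \<in> (r c)\<^sup>*" using v by (meson rtrancl.rtrancl_into_rtrancl)
      qed
    qed
    define T where "T n = ((\<lambda>S. S + \<Psi>) ^^ n) Base" for n
    have T_fin: "finite (T n)" for n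
      by (induction n) (auto simp: T_def fin intro!: finite_set_plus)
    have T_reach: "w \<in> T n" if "v \<in> Base" "(v, w) \<in> r c ^^ n" for v w c n
      using that(2)
    proof (induction n arbitrary: w)
      case 0
      then show ?case using that by (simp add: T_def)
    next
      case (Suc n)
      then obtain w' where "w' \<in> T n" "w - w' \<in> \<Psi>" by (auto simp: r_def)
      then have "w' + (w - w') \<in> T n + \<Psi>" by (rule set_plus_intro)
      then show ?case by (simp add: T_def)
    qed
    have "{w. \<exists>a\<in>A. \<exists>b\<in>A. \<exists>c\<in>A. w = a - b - c \<and> sup_norm d w \<le> \<rho>} \<subseteq> (\<Union>n\<le>N * N. T n)"
    proof safe
      fix a b c assume abc: "a \<in> A" "b \<in> A" "c \<in> A" "sup_norm d (a - b - c) \<le> \<rho>"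
      then obtain v where v: "v \<in> Base" "(v, a - b - c) \<in> (r c)\<^sup>*" using reach by blast
      then obtain n where "n \<le> card (r c)" "(v, a - b - c) \<in> r c ^^ n"
        using rtrancl_finite_eq_relpow[OF r_fin[OF abc(3)]] by auto
      then show "a - b - c \<in> (\<Union>n\<le>N * N. T n)"
        using T_reach[OF v(1)] r_card[OF abc(3)] by force
    qed
    then show ?thesis using T_fin by (meson finite_UN_I finite_atMost finite_subset)
  qed
  show ?thesis by (rule finite_subset[OF _ main[of "max \<rho> R"]]) auto
qed

text \<open>Extending \<open>z\<close> to all of \<open>\<real>\<^sup>d\<close> through nearby points of \<open>A\<close> gives an approximately additive
  function. The additive function near it, from Hyers's theorem, is bounded on bounded sets, as only
  finitely many points of \<open>A\<close> are involved there, and hence it is linear.\<close>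

proposition quasi_additive_imp_near_linear:
  fixes z :: "(nat \<Rightarrow> real) \<Rightarrow> real"
  assumes quasi: "\<And>a b c. a \<in> A \<Longrightarrow> b \<in> A \<Longrightarrow> c \<in> A \<Longrightarrow> sup_norm d (a - b - c) \<le> 3 * R \<Longrightarrow>
                    \<bar>z a - z b - z c\<bar> \<le> E"
  obtains u where "\<And>a. a \<in> A \<Longrightarrow> \<bar>z a - (\<Sum>j<d. u j * a j)\<bar> \<le> E"
proof -
  have "\<exists>a. a \<in> A \<and> sup_norm d (a - x) \<le> R \<and> (x \<in> A \<longrightarrow> a = x)" if "x \<in> Rn d" for x
  proof (cases "x \<in> A")
    case True
    then show ?thesis using R_pos by (intro exI[of _ x]) (auto simp: sup_norm_le_iff)
  qed (use dense[OF that] in auto)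
  then obtain \<alpha> where \<alpha>: "\<And>x. x \<in> Rn d \<Longrightarrow> \<alpha> x \<in> A" "\<And>x. x \<in> Rn d \<Longrightarrow> sup_norm d (\<alpha> x - x) \<le> R"
    "\<And>x. x \<in> A \<Longrightarrow> \<alpha> x = x" using in_Rn by metis
  have "\<bar>z (\<alpha> (x + y)) - z (\<alpha> x) - z (\<alpha> y)\<bar> \<le> E" if xy: "x \<in> Rn d" "y \<in> Rn d" for x y
  proof (rule quasi)
    have "sup_norm d ((\<alpha> (x + y) - (x + y)) - (\<alpha> x - x)) \<le> R + R"
      using \<alpha>(2)[OF Rn_add[OF xy]] \<alpha>(2)[OF xy(1)]
        sup_norm_triangle_diff[of d "\<alpha> (x + y) - (x + y)" "\<alpha> x - x"] by linarith
    then have "sup_norm d (\<alpha> (x + y) - \<alpha> x - \<alpha> y) \<le> (R + R) + R"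
      by (rule sup_norm_sum_le[rotated, where y = "y - \<alpha> y"])
        (use \<alpha>(2)[OF xy(2)] in \<open>auto simp: sup_norm_minus_commute[of d y] algebra_simps\<close>)
    then show "sup_norm d (\<alpha> (x + y) - \<alpha> x - \<alpha> y) \<le> 3 * R" by simp
  qed (use \<alpha> xy Rn_add in auto)
  then obtain g where g: "\<And>x y. x \<in> Rn d \<Longrightarrow> y \<in> Rn d \<Longrightarrow> g (x + y) = g x + g y"
      "\<And>x. x \<in> Rn d \<Longrightarrow> \<bar>g x - z (\<alpha> x)\<bar> \<le> E"
    using hyers[of "Rn d" "\<lambda>x. z (\<alpha> x)" E] Rn_add by blast
  define M where "M = Max (insert 0 ((\<lambda>a. \<bar>z a\<bar>) ` {a \<in> A. sup_norm d a \<le> R + 1}))"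
  have "\<bar>g x\<bar> \<le> M + E" if "x \<in> Rn d" "sup_norm d x \<le> 1" for x
  proof -
    have "sup_norm d (\<alpha> x) \<le> R + 1"
      using \<alpha>(2)[OF that(1)] that(2) by (intro sup_norm_sum_le[where x = "\<alpha> x - x"]) auto
    then have "\<bar>z (\<alpha> x)\<bar> \<le> M"
      unfolding M_def using \<alpha>(1)[OF that(1)] finite_ball by (intro Max_ge) auto
    then show ?thesis using g(2)[OF that(1)] by linarith
  qed
  then obtain u where u: "\<And>x. x \<in> Rn d \<Longrightarrow> g x = (\<Sum>j<d. u j * x j)"
    using additive_bounded_on_Rn[OF g(1)] by blast
  have "\<bar>z a - (\<Sum>j<d. u j * a j)\<bar> \<le> E" if "a \<in> A" for a
    using g(2)[OF in_Rn[OF that]] u[OF in_Rn[OF that]] \<alpha>(3)[OF that] by simp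
  then show ?thesis using that by blast
qed

end

section \<open>Covering by cosets of a group of least rank\<close>

definition int_comb :: "nat set \<Rightarrow> (nat \<Rightarrow> nat \<Rightarrow> real) \<Rightarrow> (nat \<Rightarrow> int) \<Rightarrow> nat \<Rightarrow> real" where
  "int_comb I h z = (\<lambda>j. \<Sum>i\<in>I. of_int (z i) * h i j)"

definition coset_cover ::
    "nat \<Rightarrow> nat set \<Rightarrow> (nat \<Rightarrow> nat \<Rightarrow> real) \<Rightarrow> (nat \<Rightarrow> real) set \<Rightarrow> (nat \<Rightarrow> real) set \<Rightarrow> bool" where
  "coset_cover d I h F A \<longleftrightarrow> (\<forall>i\<in>I. h i \<in> Rn d) \<and> finite F \<and> F \<subseteq> Rn d \<and>
     (\<forall>a\<in>A. \<exists>z. \<exists>f\<in>F. a = int_comb I h z + f)"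

lemma int_comb_add: "int_comb I h (\<lambda>i. y i + z i) = int_comb I h y + int_comb I h z"
  by (auto simp: int_comb_def fun_eq_iff distrib_right sum.distrib)

lemma int_comb_diff: "int_comb I h (\<lambda>i. y i - z i) = int_comb I h y - int_comb I h z"
  by (auto simp: int_comb_def fun_eq_iff left_diff_distrib sum_subtractf)

lemma int_comb_scale: "int_comb I h (\<lambda>i. c * z i) = (\<lambda>j. of_int c * int_comb I h z j)"
  by (auto simp: int_comb_def fun_eq_iff sum_distrib_left mult.assoc)

lemma int_comb_cong: "(\<And>i. i \<in> I \<Longrightarrow> y i = z i) \<Longrightarrow> int_comb I h y = int_comb I h z"
  by (auto simp: int_comb_def fun_eq_iff intro!: sum.cong)

lemma int_comb_Rn: "(\<And>i. i \<in> I \<Longrightarrow> h i \<in> Rn d) \<Longrightarrow> int_comb I h z \<in> Rn d"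
  by (auto simp: int_comb_def Rn_iff)

text \<open>
  If a nonzero integer functional \<open>n\<close> takes only finitely many values \<open>v\<close> on the coordinate vectors
  in use, then one generator can be dropped: subtracting multiples of \<open>h p\<close> from the other
  generators leaves \<open>(v / n\<^sub>p) h p\<close> of the whole contribution of \<open>h p\<close>.
\<close>

lemma coset_cover_drop_generator:
  assumes "finite I" "p \<in> I" "n p \<noteq> (0::int)" "finite V" "finite F" "F \<subseteq> Rn d"
    and h: "\<And>i. i \<in> I \<Longrightarrow> h i \<in> Rn d"
    and cover: "\<And>a. a \<in> A \<Longrightarrow> \<exists>z. \<exists>f\<in>F. a = int_comb I h z + f \<and> (\<Sum>i\<in>I. n i * z i) \<in> V"
  obtains h' F' where "coset_cover d (I - {p}) h' F' A"
proof -
  define h' where "h' i j = h i j - of_int (n i) / of_int (n p) * h p j" for i j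
  define F' where "F' = (\<lambda>(v, f) j. of_int v / of_int (n p) * h p j + f j) ` (V \<times> F)"
  have split: "int_comb I h z j = int_comb (I - {p}) h' z j + of_int (\<Sum>i\<in>I. n i * z i) / of_int (n p) * h p j"
    for z j
  proof -
    have sum: "(\<Sum>i\<in>I. g i) = g p + (\<Sum>i\<in>I - {p}. g i)" for g :: "nat \<Rightarrow> real"
      using assms(1,2) by (rule sum.remove)
    have "int_comb (I - {p}) h' z j = (\<Sum>i\<in>I - {p}. of_int (z i) * h i j)
        - (\<Sum>i\<in>I - {p}. of_int (n i) * of_int (z i)) / of_int (n p) * h p j"
      unfolding int_comb_def h'_def sum_divide_distrib sum_distrib_right sum_subtractf[symmetric]
      by (intro sum.cong) (auto simp: right_diff_distrib)
    moreover have "of_int (\<Sum>i\<in>I. n i * z i)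
        = of_int (n p) * of_int (z p) + (\<Sum>i\<in>I - {p}. of_int (n i) * of_int (z i) :: real)"
      using sum[of "\<lambda>i. of_int (n i) * of_int (z i)"] by simp
    moreover have "int_comb I h z j = of_int (z p) * h p j + (\<Sum>i\<in>I - {p}. of_int (z i) * h i j)"
      unfolding int_comb_def by (rule sum)
    ultimately show ?thesis using assms(3) by (simp add: field_simps)
  qed
  have "coset_cover d (I - {p}) h' F' A"
    unfolding coset_cover_def
  proof (intro conjI ballI)
    show "h' i \<in> Rn d" if "i \<in> I - {p}" for i
      using that h[of i] h[OF assms(2)] by (auto simp: h'_def Rn_iff)
    show "finite F'" using assms by (simp add: F'_def)
    show "F' \<subseteq> Rn d" using h[OF assms(2)] assms(6) by (auto simp: F'_def Rn_iff subset_iff)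
  next
    fix a assume "a \<in> A"
    then obtain z f where z: "f \<in> F" "a = int_comb I h z + f" "(\<Sum>i\<in>I. n i * z i) \<in> V"
      using cover by blast
    let ?f = "\<lambda>j. of_int (\<Sum>i\<in>I. n i * z i) / of_int (n p) * h p j + f j"
    have "?f \<in> F'" unfolding F'_def using z by (intro image_eqI[of _ _ "(\<Sum>i\<in>I. n i * z i, f)"]) auto
    moreover have "a = int_comb (I - {p}) h' z + ?f"
      unfolding z(2) by (rule ext) (simp only: plus_fun_apply split add.assoc)
    ultimately show "\<exists>z. \<exists>f\<in>F'. a = int_comb (I - {p}) h' z + f" by blast
  qed
  then show ?thesis by (rule that)
qed

lemma coset_cover_reindex:
  assumes "finite I" "coset_cover d I h F A"
  obtains h' where "coset_cover d {..<card I} h' F A"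
proof -
  obtain \<sigma> where \<sigma>: "bij_betw \<sigma> {..<card I} I"
    using ex_bij_betw_nat_finite[OF assms(1)] by (auto simp: atLeast0LessThan)
  have "int_comb I h z = int_comb {..<card I} (h \<circ> \<sigma>) (z \<circ> \<sigma>)" for z
    unfolding int_comb_def comp_def
    by (rule ext) (rule sum.reindex_bij_betw[OF \<sigma>, symmetric])
  then have "coset_cover d {..<card I} (h \<circ> \<sigma>) F A"
    using assms(2) bij_betwE[OF \<sigma>] unfolding coset_cover_def by (metis comp_apply)
  then show ?thesis by (rule that)
qed

definition linear_map :: "nat \<Rightarrow> (nat \<Rightarrow> nat \<Rightarrow> real) \<Rightarrow> (nat \<Rightarrow> real) \<Rightarrow> nat \<Rightarrow> real" where
  "linear_map d u x i = (\<Sum>j<d. u i j * x j)"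

lemma linear_map_add: "linear_map d u (x + y) i = linear_map d u x i + linear_map d u y i"
  and linear_map_diff: "linear_map d u (x - y) i = linear_map d u x i - linear_map d u y i"
  and linear_map_scale: "linear_map d u (\<lambda>j. c * x j) i = c * linear_map d u x i"
  by (simp_all add: linear_map_def distrib_left right_diff_distrib sum.distrib sum_subtractf
      sum_distrib_left mult_ac)

lemma linear_map_bound: "\<bar>linear_map d u x i\<bar> \<le> (\<Sum>j<d. \<bar>u i j\<bar>) * sup_norm d x"
proof -
  have "\<bar>linear_map d u x i\<bar> \<le> (\<Sum>j<d. \<bar>u i j * x j\<bar>)"
    unfolding linear_map_def by (rule sum_abs)
  also have "\<dots> \<le> (\<Sum>j<d. \<bar>u i j\<bar> * sup_norm d x)"
    by (intro sum_mono) (auto simp: abs_mult intro!: mult_left_mono abs_le_sup_norm)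
  finally show ?thesis by (simp add: sum_distrib_right)
qed

context meyer_set
begin

lemma ex_coset_cover: "\<exists>r h F. coset_cover d {..<r} h F A"
proof -
  obtain b where b: "b \<in> A" using nonempty by auto
  define r where "r = card (small_diffs (3 * R))"
  obtain h where h: "bij_betw h {..<r} (small_diffs (3 * R))"
    using ex_bij_betw_nat_finite[OF finite_small_diffs] by (auto simp: atLeast0LessThan r_def)
  have "\<exists>z. a = int_comb {..<r} h z + b" if "a \<in> A" for a
    using that b
  proof (induction rule: chain_induct)
    case base
    show ?case by (intro exI[of _ "\<lambda>_. 0"]) (auto simp: int_comb_def fun_eq_iff)
  next
    case (step a a')
    then obtain z where z: "a' = int_comb {..<r} h z + b" by blast
    have "a - a' \<in> small_diffs (3 * R)" using step by (intro small_diffsI)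
    then have "a - a' \<in> h ` {..<r}" using h by (simp only: bij_betw_def)
    then obtain i where i: "i < r" "h i = a - a'" by (metis imageE lessThan_iff)
    have "int_comb {..<r} h (\<lambda>k. if k = i then 1 else 0) = h i"
      using i(1) by (simp add: int_comb_def fun_eq_iff if_distrib[of "\<lambda>c. c * _"]
          if_distrib[of of_int] cong: if_cong)
    then have "a = int_comb {..<r} h (\<lambda>k. z k + (if k = i then 1 else 0)) + b"
      unfolding int_comb_add i(2) using z by (simp add: algebra_simps)
    then show ?case by blast
  qed
  moreover have "h i \<in> Rn d" if "i < r" for i
  proof -
    have "h i \<in> small_diffs (3 * R)" using h that by (auto simp: bij_betw_def)
    then show ?thesis using in_Rn Rn_diff by (auto simp: small_diffs_def minkowski_diff_def)
  qed
  ultimately have "coset_cover d {..<r} h {b} A"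
    using b in_Rn by (auto simp: coset_cover_def)
  then show ?thesis by blast
qed

text \<open>A cover of least rank admits no functional as in \<open>coset_cover_drop_generator\<close>. In
  particular its generators are independent: along a relation \<open>\<Sum> n\<^sub>i h\<^sub>i = 0\<close> the coordinate
  \<open>z\<^sub>p\<close> can be reduced modulo \<open>n\<^sub>p\<close>, and so the \<open>p\<close>-th coordinate is such a functional.\<close>

lemma minimal_coset_cover:
  obtains r h F where "coset_cover d {..<r} h F A"
    and "\<And>n V. finite V \<Longrightarrow> (\<And>a. a \<in> A \<Longrightarrow> \<exists>z. \<exists>f\<in>F. a = int_comb {..<r} h z + f \<and> (\<Sum>i<r. n i * z i) \<in> V)
           \<Longrightarrow> \<forall>i<r. n i = 0"
    and "\<And>n. int_comb {..<r} h n = 0 \<Longrightarrow> \<forall>i<r. n i = 0"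
proof -
  define r where "r = (LEAST r. \<exists>h F. coset_cover d {..<r} h F A)"
  have "\<exists>h F. coset_cover d {..<r} h F A"
    unfolding r_def using ex_coset_cover by (rule LeastI_ex)
  then obtain h F where cover: "coset_cover d {..<r} h F A" by blast
  have no_functional: "\<forall>i<r. n i = 0"
    if finV: "finite V" and vals: "\<And>a. a \<in> A \<Longrightarrow> \<exists>z. \<exists>f\<in>F. a = int_comb {..<r} h z + f \<and> (\<Sum>i<r. n i * z i) \<in> V"
    for n V
  proof (rule ccontr)
    assume "\<not> (\<forall>i<r. n i = 0)"
    then obtain p where p: "p < r" "n p \<noteq> 0" by blast
    have p': "finite {..<r}" "p \<in> {..<r}" using p by auto
    have "finite F" "F \<subseteq> Rn d" "\<And>i. i \<in> {..<r} \<Longrightarrow> h i \<in> Rn d"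
      using cover by (auto simp: coset_cover_def)
    then obtain h' F' where "coset_cover d ({..<r} - {p}) h' F' A"
      using coset_cover_drop_generator[OF p' p(2) finV _ _ _ vals] by metis
    then obtain h'' where "coset_cover d {..<card ({..<r} - {p})} h'' F' A"
      by (rule coset_cover_reindex[rotated]) auto
    then have "r \<le> card ({..<r} - {p})" unfolding r_def by (blast intro: Least_le)
    then show False using p by simp
  qed
  have "\<forall>i<r. n i = 0" if n: "int_comb {..<r} h n = 0" for n
  proof (rule ccontr)
    assume "\<not> (\<forall>i<r. n i = 0)"
    then obtain p where p: "p < r" "n p \<noteq> 0" by blast
    let ?e = "\<lambda>i. if i = p then 1 else 0 :: int"
    have "\<forall>i<r. ?e i = 0"
    proof (rule no_functional[of "{-\<bar>n p\<bar>..\<bar>n p\<bar>}"])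
      fix a assume "a \<in> A"
      then obtain z f where z: "f \<in> F" "a = int_comb {..<r} h z + f"
        using cover by (auto simp: coset_cover_def)
      let ?z = "\<lambda>i. z i - (z p div n p) * n i"
      have "int_comb {..<r} h ?z = int_comb {..<r} h z"
        unfolding int_comb_diff int_comb_scale n by (auto simp: fun_eq_iff)
      moreover have "(\<Sum>i<r. ?e i * ?z i) = ?z p"
        using p by (simp add: if_distrib[of "\<lambda>c. c * _"] cong: if_cong)
      moreover have "?z p = z p mod n p" by (simp add: minus_div_mult_eq_mod)
      moreover have "\<bar>z p mod n p\<bar> \<le> \<bar>n p\<bar>" using abs_mod_less[OF p(2), of "z p"] by simp
      ultimately show "\<exists>z. \<exists>f\<in>F. a = int_comb {..<r} h z + f \<and> (\<Sum>i<r. ?e i * z i) \<in> {-\<bar>n p\<bar>..\<bar>n p\<bar>}"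
        using z by (intro exI[of _ ?z] bexI[of _ f]) auto
    qed auto
    then show False using p by auto
  qed
  then show ?thesis using that cover no_functional by blast
qed

end

locale meyer_coordinates = meyer_set +
  fixes r :: nat and h :: "nat \<Rightarrow> nat \<Rightarrow> real" and F :: "(nat \<Rightarrow> real) set"
    and z :: "(nat \<Rightarrow> real) \<Rightarrow> nat \<Rightarrow> int" and f :: "(nat \<Rightarrow> real) \<Rightarrow> (nat \<Rightarrow> real)"
    and u :: "nat \<Rightarrow> nat \<Rightarrow> real" and E :: real
  assumes F: "finite F" "F \<subseteq> Rn d"
    and h_Rn: "i < r \<Longrightarrow> h i \<in> Rn d"
    and f_in: "a \<in> A \<Longrightarrow> f a \<in> F"
    and decomp: "a \<in> A \<Longrightarrow> a = int_comb {..<r} h (z a) + f a"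
    and near_linear: "a \<in> A \<Longrightarrow> i < r \<Longrightarrow> \<bar>of_int (z a i) - linear_map d u a i\<bar> \<le> E"
    and indep_h: "int_comb {..<r} h n = 0 \<Longrightarrow> \<forall>i<r. n i = 0"
    and indep_u: "\<forall>j<d. (\<Sum>i<r. of_int (n i) * u i j) = 0 \<Longrightarrow> \<forall>i<r. n i = 0"

text \<open>
  Coordinates with respect to a cover of least rank. By the Meyer property and the independence of the
  generators, coordinates are approximately additive, hence close to a linear map. An integer relation
  between the rows of this map would make a functional bounded on the coordinate vectors, and
  thus again contradict the minimality of the rank.
\<close>

proposition (in meyer_set) linear_coordinates:
  obtains r h F z f u E where "meyer_coordinates d A R r h F z f u E"
proof -
  obtain r h F where cover: "coset_cover d {..<r} h F A"
    and no_functional: "\<And>n V. finite V \<Longrightarrow> (\<And>a. a \<in> A \<Longrightarrow>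
          \<exists>z. \<exists>f\<in>F. a = int_comb {..<r} h z + f \<and> (\<Sum>i<r. n i * z i) \<in> V) \<Longrightarrow> \<forall>i<r. n i = 0"
    and indep: "\<And>n. int_comb {..<r} h n = 0 \<Longrightarrow> \<forall>i<r. n i = 0"
    using minimal_coset_cover by blast
  have F: "finite F" "F \<subseteq> Rn d" and h: "\<And>i. i < r \<Longrightarrow> h i \<in> Rn d"
    using cover by (auto simp: coset_cover_def)
  from cover have "\<forall>a\<in>A. \<exists>p. snd p \<in> F \<and> a = int_comb {..<r} h (fst p) + snd p"
    unfolding coset_cover_def by (metis fst_conv snd_conv)
  then obtain p where p: "\<And>a. a \<in> A \<Longrightarrow> snd (p a) \<in> F \<and> a = int_comb {..<r} h (fst (p a)) + snd (p a)"
    by metis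
  define z where "z a = fst (p a)" for a
  define f where "f a = snd (p a)" for a
  have zf: "f a \<in> F" "a = int_comb {..<r} h (z a) + f a" if "a \<in> A" for a
    using p[OF that] by (auto simp: z_def f_def)
  define \<Theta> where "\<Theta> = {w. \<exists>a\<in>A. \<exists>b\<in>A. \<exists>c\<in>A. w = a - b - c \<and> sup_norm d w \<le> 3 * R}"
  define T where "T = (\<lambda>(w, f1, f2, f3). w - f1 + f2 + f3) ` (\<Theta> \<times> F \<times> F \<times> F)"
  have T: "finite T"
    unfolding T_def \<Theta>_def using F(1) finite_small_triple_diffs by blast
  define g where "g t = (SOME n. int_comb {..<r} h n = t)" for t
  define E where "E = (\<Sum>i<r. \<Sum>t\<in>T. \<bar>real_of_int (g t i)\<bar>)"
  have quasi: "\<bar>real_of_int (z a i) - real_of_int (z b i) - real_of_int (z c i)\<bar> \<le> E"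
    if i: "i < r" and abc: "a \<in> A" "b \<in> A" "c \<in> A" and small: "sup_norm d (a - b - c) \<le> 3 * R"
    for i a b c
  proof -
    define n where "n = (\<lambda>i. z a i - z b i - z c i)"
    define t where "t = int_comb {..<r} h n"
    have "int_comb {..<r} h (z x) = x - f x" if "x \<in> A" for x
      using zf(2)[OF that] by (metis add_diff_cancel_right')
    then have "t = (a - b - c) - f a + f b + f c"
      unfolding t_def n_def int_comb_diff using abc by simp
    moreover have "a - b - c \<in> \<Theta>" using abc small by (auto simp: \<Theta>_def)
    ultimately have "t \<in> T"
      unfolding T_def using zf(1) abc by (intro image_eqI[of _ _ "(a - b - c, f a, f b, f c)"]) auto
    have "int_comb {..<r} h (g t) = t" unfolding g_def by (rule someI[of _ n]) (simp add: t_def)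
    then have "int_comb {..<r} h (\<lambda>i. g t i - n i) = 0" unfolding int_comb_diff t_def by simp
    then have "n i = g t i" using indep i by fastforce
    moreover have "\<bar>real_of_int (g t i)\<bar> \<le> (\<Sum>t\<in>T. \<bar>real_of_int (g t i)\<bar>)"
      using \<open>t \<in> T\<close> T by (intro member_le_sum) auto
    moreover have "\<dots> \<le> E"
      unfolding E_def using i by (intro member_le_sum) (auto intro: sum_nonneg)
    ultimately show ?thesis by (simp add: n_def flip: of_int_diff)
  qed
  have "\<exists>v. \<forall>a\<in>A. \<bar>real_of_int (z a i) - (\<Sum>j<d. v j * a j)\<bar> \<le> E" if "i < r" for i
  proof (rule quasi_additive_imp_near_linear[of "\<lambda>a. real_of_int (z a i)" E])
    fix v assume "\<And>a. a \<in> A \<Longrightarrow> \<bar>real_of_int (z a i) - (\<Sum>j<d. v j * a j)\<bar> \<le> E"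
    then show ?thesis by blast
  qed (rule quasi[OF that])
  then obtain u where "\<And>i. i < r \<Longrightarrow> \<forall>a\<in>A. \<bar>real_of_int (z a i) - (\<Sum>j<d. u i j * a j)\<bar> \<le> E"
    by metis
  then have u: "\<bar>real_of_int (z a i) - linear_map d u a i\<bar> \<le> E" if "a \<in> A" "i < r" for a i
    using that by (simp add: linear_map_def)
  have indep_u: "\<forall>i<r. n i = 0" if n: "\<forall>j<d. (\<Sum>i<r. of_int (n i) * u i j) = 0" for n
  proof (rule no_functional)
    define B where "B = (\<Sum>i<r. \<bar>real_of_int (n i)\<bar> * E)"
    show "finite {- \<lceil>B\<rceil>..\<lceil>B\<rceil>}" by simp
    fix a assume a: "a \<in> A"
    have "(\<Sum>i<r. of_int (n i) * linear_map d u a i) = (\<Sum>j<d. (\<Sum>i<r. of_int (n i) * u i j) * a j)"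
      unfolding linear_map_def sum_distrib_left sum_distrib_right
      by (subst sum.swap) (simp add: mult_ac)
    also have "\<dots> = 0" using n by simp
    finally have "real_of_int (\<Sum>i<r. n i * z a i)
        = (\<Sum>i<r. of_int (n i) * (of_int (z a i) - linear_map d u a i))"
      by (simp add: right_diff_distrib sum_subtractf)
    also have "\<bar>\<dots>\<bar> \<le> (\<Sum>i<r. \<bar>of_int (n i) * (of_int (z a i) - linear_map d u a i)\<bar>)"
      by (rule sum_abs)
    also have "\<dots> \<le> B"
      unfolding B_def abs_mult using u[OF a] by (intro sum_mono mult_left_mono) auto
    finally have "\<bar>\<Sum>i<r. n i * z a i\<bar> \<le> \<lceil>B\<rceil>"
      by (metis ceiling_mono ceiling_of_int of_int_abs)
    then show "\<exists>z. \<exists>f\<in>F. a = int_comb {..<r} h z + f \<and> (\<Sum>i<r. n i * z i) \<in> {- \<lceil>B\<rceil>..\<lceil>B\<rceil>}"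
      using zf[OF a] by (intro exI[of _ "z a"] bexI[of _ "f a"]) auto
  qed
  have "meyer_coordinates d A R r h F z f u E"
    by unfold_locales (fact F h zf u indep indep_u)+
  then show ?thesis by (rule that)
qed

section \<open>A line meeting all residue classes\<close>

text \<open>The moment curve \<open>(1, t, t\<^sup>2, \<dots>)\<close> meets each of the countably many hyperplanes in question
  only finitely often.\<close>

lemma generic_direction:
  assumes indep: "\<And>n. \<forall>j<d. (\<Sum>i<r. of_int (n i) * u i j) = 0 \<Longrightarrow> \<forall>i<r. n i = (0::int)"
  obtains x where "x \<in> Rn d"
    "\<And>n. (\<Sum>i<r. of_int (n i) * linear_map d u x i) = 0 \<Longrightarrow> \<forall>i<r. n i = (0::int)"
proof -
  define x where "x t = (\<lambda>j. if j < d then t ^ j else 0)" for t :: real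
  define c where "c n j = (if j < d then (\<Sum>i<r. of_int (n i) * u i j) else 0)" for n :: "nat \<Rightarrow> int" and j
  have on_curve: "(\<Sum>i<r. of_int (n i) * linear_map d u (x t) i) = (\<Sum>j\<le>d. c n j * t ^ j)" for n t
  proof -
    have "(\<Sum>i<r. of_int (n i) * linear_map d u (x t) i)
        = (\<Sum>j<d. (\<Sum>i<r. of_int (n i) * u i j) * t ^ j)"
      unfolding linear_map_def sum_distrib_left sum_distrib_right x_def
      by (subst sum.swap) (simp add: mult_ac)
    also have "\<dots> = (\<Sum>j<Suc d. c n j * t ^ j)" by (simp add: c_def)
    finally show ?thesis by (simp only: lessThan_Suc_atMost)
  qed
  define N where "N = {n \<in> PiE {..<r} (\<lambda>_. UNIV :: int set). \<exists>i<r. n i \<noteq> 0}"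
  have "countable (\<Union>n\<in>N. {t. (\<Sum>j\<le>d. c n j * t ^ j) = 0})"
  proof (intro countable_UN)
    show "countable N"
      by (rule countable_subset[OF _ countable_PiE[of "{..<r}" "\<lambda>_. UNIV :: int set"]]) (auto simp: N_def)
    fix n assume "n \<in> N"
    then obtain j where "j < d" "(\<Sum>i<r. of_int (n i) * u i j) \<noteq> 0"
      using indep[of n] by (auto simp: N_def)
    then have "\<exists>j\<le>d. c n j \<noteq> 0" by (intro exI[of _ j]) (auto simp: c_def)
    then show "countable {t. (\<Sum>j\<le>d. c n j * t ^ j) = 0}"
      by (intro countable_finite) (simp add: polyfun_finite_roots)
  qed
  then have "(\<Union>n\<in>N. {t. (\<Sum>j\<le>d. c n j * t ^ j) = 0}) \<noteq> UNIV"
    using uncountable_UNIV_real by (intro notI) simp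
  then obtain t where t: "t \<notin> (\<Union>n\<in>N. {t. (\<Sum>j\<le>d. c n j * t ^ j) = 0})"
    by blast
  have "\<forall>i<r. n i = 0" if n: "(\<Sum>i<r. of_int (n i) * linear_map d u (x t) i) = 0" for n
  proof (rule ccontr)
    assume "\<not> (\<forall>i<r. n i = 0)"
    then have "restrict n {..<r} \<in> N" by (auto simp: N_def)
    then have "(\<Sum>i<r. of_int (restrict n {..<r} i) * linear_map d u (x t) i) \<noteq> 0"
      using t unfolding on_curve by blast
    moreover have "(\<Sum>i<r. of_int (restrict n {..<r} i) * linear_map d u (x t) i)
        = (\<Sum>i<r. of_int (n i) * linear_map d u (x t) i)" by (intro sum.cong) auto
    ultimately show False using n by simp
  qed
  then show ?thesis using that[of "x t"] by (auto simp: x_def Rn_iff)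
qed

text \<open>Kronecker's theorem, applied to the target point \<open>m / 2\<^sup>k\<close> of the torus.\<close>

lemma line_near_all_residue_classes:
  fixes \<theta> :: "nat \<Rightarrow> real" and m :: "nat \<Rightarrow> int"
  assumes indep: "\<And>n. (\<Sum>i<r. of_int (n i) * \<theta> i) = 0 \<Longrightarrow> \<forall>i<r. n i = (0::int)"
  obtains \<tau> w where "\<And>i. i < r \<Longrightarrow> \<bar>\<tau> * \<theta> i - of_int (w i)\<bar> < 1"
    "\<And>i. i < r \<Longrightarrow> w i mod 2 ^ k = m i mod 2 ^ k"
proof -
  interpret Modules.module "(\<lambda>r. (*) (real_of_int r))"
    by (simp add: Modules.module.intro distrib_left mult.commute)
  have inj: "inj_on \<theta> {..<r}"
  proof (rule inj_onI, rule ccontr)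
    fix i j assume ij: "i \<in> {..<r}" "j \<in> {..<r}" "\<theta> i = \<theta> j" "i \<noteq> j"
    let ?n = "\<lambda>l. (if l = i then 1 else 0) - (if l = j then 1 else 0 :: int)"
    have "(\<Sum>l<r. of_int (?n l) * \<theta> l) = \<theta> i - \<theta> j"
      using ij by (simp add: left_diff_distrib sum_subtractf if_distrib[of "\<lambda>c. c * _"]
          if_distrib[of of_int] cong: if_cong)
    then have "\<forall>l<r. ?n l = 0" using indep[of ?n] ij by simp
    then have "?n i = 0" using ij by blast
    then show False using ij by simp
  qed
  have "\<not> dependent (\<theta> ` {..<r})"
  proof
    assume "dependent (\<theta> ` {..<r})"
    then obtain v where v: "\<exists>y\<in>\<theta> ` {..<r}. v y \<noteq> 0" "(\<Sum>y\<in>\<theta> ` {..<r}. of_int (v y) * y) = 0"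
      by (auto simp: dependent_finite)
    have "(\<Sum>i<r. of_int (v (\<theta> i)) * \<theta> i) = 0"
      using v(2) by (simp add: sum.reindex[OF inj])
    then show False using indep[of "\<lambda>i. v (\<theta> i)"] v(1) by auto
  qed
  then obtain t h where th: "\<And>i. i < r \<Longrightarrow> \<bar>t * \<theta> i - of_int (h i) - of_int (m i) / 2 ^ k\<bar> < 1 / 2 ^ k"
    using Kronecker_thm_1[OF _ inj, of "1 / 2 ^ k" "\<lambda>i. of_int (m i) / 2 ^ k"] by auto
  show ?thesis
  proof (rule that)
    fix i assume "i < r"
    have "2 ^ k * t * \<theta> i - of_int (2 ^ k * h i + m i)
        = 2 ^ k * (t * \<theta> i - of_int (h i) - of_int (m i) / 2 ^ k)"
      by (simp add: field_simps)
    then show "\<bar>2 ^ k * t * \<theta> i - of_int (2 ^ k * h i + m i)\<bar> < 1"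
      using th[OF \<open>i < r\<close>] by (simp add: abs_mult pos_less_divide_eq mult.commute)
    show "(2 ^ k * h i + m i) mod 2 ^ k = m i mod 2 ^ k" by simp
  qed
qed

section \<open>The bound on the rank\<close>

lemma large_fibre:
  assumes "finite X" "finite V" "g ` X \<subseteq> V" "X \<noteq> {}"
  obtains y where "y \<in> V" "card X \<le> card V * card {x \<in> X. g x = y}"
proof -
  have "\<exists>y\<in>V. card (g -` {y} \<inter> X) * card V \<ge> card X"
    using assms by (intro pigeonhole_card) auto
  moreover have "g -` {y} \<inter> X = {x \<in> X. g x = y}" for y by auto
  ultimately show ?thesis using that by (auto simp: mult.commute)
qed

context meyer_coordinates
begin

lemma int_comb_inject: "int_comb {..<r} h n = int_comb {..<r} h n' \<Longrightarrow> i < r \<Longrightarrow> n i = n' i"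
  using indep_h[of "\<lambda>i. n i - n' i"] by (simp add: int_comb_diff)

lemma diff_same_shift:
  assumes "a \<in> A" "b \<in> A" "f a = f b"
  shows "a - b = int_comb {..<r} h (\<lambda>i. z a i - z b i)"
  using decomp[OF assms(1)] decomp[OF assms(2)] assms(3) unfolding int_comb_diff
  by (metis add_diff_cancel_right)

text \<open>Equality of the shifts \<open>f\<close> makes all differences within \<open>Y\<close> elements of the group generated by
  the vectors \<open>h i\<close>, so that \<open>Y\<close> lies in one coset of \<open>q\<close> times this group.\<close>

definition congruent_mod :: "nat \<Rightarrow> (nat \<Rightarrow> real) set \<Rightarrow> bool" where
  "congruent_mod q Y \<longleftrightarrow>
     (\<forall>a\<in>Y. \<forall>b\<in>Y. f a = f b \<and> (\<forall>i<r. z a i mod int q = z b i mod int q))"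

text \<open>
  Let \<open>X\<close> be as in \<open>card_diff_dyadic_dilate\<close>, and let \<open>S0\<close> be a large part of \<open>S\<close> with constant shift
  \<open>f\<close>. Since \<open>2\<^sup>k S0\<close> lies in one class modulo \<open>2\<^sup>k\<close>, representatives of the classes that \<open>X\<close> meets
  give disjoint sets \<open>x - 2\<^sup>k S0\<close> inside \<open>X - 2\<^sup>k S\<close>. So these classes are few, and one of them is large.
\<close>

lemma popular_residue_class:
  fixes \<kappa> :: real
  assumes S: "S \<subseteq> A" "finite S" "S \<noteq> {}" and doubling: "card (S + uminus ` S) \<le> \<kappa> * card S"
  obtains Y where "Y \<subseteq> S" "congruent_mod (2 ^ k) Y"
    "card S \<le> real (card F) ^ 2 * \<kappa> ^ (2 * k + 2) * card Y"
proof -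
  have "inj (\<lambda>x :: nat \<Rightarrow> real. x + x)" by (auto simp: inj_def fun_eq_iff)
  then obtain X where X: "X \<subseteq> S" "X \<noteq> {}" "card S \<le> \<kappa> * card X"
    and growth: "\<And>k. card (X + uminus ` (((\<lambda>x. x + x) ^^ k) ` S)) \<le> \<kappa> ^ (2 * k + 1) * card X"
    using card_diff_dyadic_dilate[OF S(2,3) doubling] by blast
  have finX: "finite X" using X(1) S(2) by (rule finite_subset)
  have XA: "X \<subseteq> A" using X(1) S(1) by blast
  have S0: "card S > 0" using S by (simp add: card_gt_0_iff)
  have "\<kappa> > 0" using X(3) S0 by (smt (verit) mult_nonpos_nonneg of_nat_0_le_iff of_nat_0_less_iff)
  define D where "D = ((\<lambda>x :: nat \<Rightarrow> real. x + x) ^^ k)"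
  have D: "D x = (\<lambda>j. 2 ^ k * x j)" for x
    unfolding D_def by (induction k) (auto simp: fun_eq_iff)
  obtain f1 where f1: "f1 \<in> F" "card X \<le> card F * card {x \<in> X. f x = f1}"
    using large_fibre[of X F f] finX F(1) XA X(2) f_in by blast
  define X1 where "X1 = {x \<in> X. f x = f1}"
  obtain f0 where f0: "f0 \<in> F" "card S \<le> card F * card {x \<in> S. f x = f0}"
    using large_fibre[of S F f] S F(1) f_in by blast
  define S0 where "S0 = {x \<in> S. f x = f0}"
  define q where "q x = restrict (\<lambda>i. z x i mod 2 ^ k) {..<r}" for x
  define Q where "Q = q ` X1"
  have finX1: "finite X1" using finX by (simp add: X1_def)
  have "X1 \<noteq> {}"
    using f1(2) X(2) finX unfolding X1_def[symmetric] by (auto simp: card_gt_0_iff)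
  then obtain y where y: "y \<in> Q" "card X1 \<le> card Q * card {x \<in> X1. q x = y}"
    using large_fibre[of X1 Q q] finX1 unfolding Q_def by blast
  define Y where "Y = {x \<in> X1. q x = y}"
  have "\<forall>p\<in>Q. \<exists>x. x \<in> X1 \<and> q x = p" by (auto simp: Q_def)
  then obtain s where s: "\<And>p. p \<in> Q \<Longrightarrow> s p \<in> X1" "\<And>p. p \<in> Q \<Longrightarrow> q (s p) = p" by metis
  have "inj_on (\<lambda>(p, a). s p - D a) (Q \<times> S0)"
  proof (rule inj_onI, clarify)
    fix p a p' a' assume p: "p \<in> Q" "p' \<in> Q" and a: "a \<in> S0" "a' \<in> S0" and eq: "s p - D a = s p' - D a'"
    have sA: "s p \<in> A" "s p' \<in> A" "f (s p) = f (s p')"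
      using s(1)[OF p(1)] s(1)[OF p(2)] XA by (auto simp: X1_def)
    have aA: "a \<in> A" "a' \<in> A" "f a = f a'" using a S(1) by (auto simp: S0_def)
    have "s p - s p' = (s p - D a) - (s p' - D a') + (D a - D a')" by simp
    then have "s p - s p' = D a - D a'" unfolding eq by simp
    also have "\<dots> = (\<lambda>j. 2 ^ k * (a - a') j)" unfolding D by (auto simp: fun_eq_iff right_diff_distrib)
    also have "\<dots> = int_comb {..<r} h (\<lambda>i. 2 ^ k * (z a i - z a' i))"
      unfolding diff_same_shift[OF aA] int_comb_scale by simp
    finally have "int_comb {..<r} h (\<lambda>i. z (s p) i - z (s p') i) = \<dots>"
      using diff_same_shift[OF sA] by simp
    then have "z (s p) i - z (s p') i = 2 ^ k * (z a i - z a' i)" if "i < r" for i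
      using int_comb_inject that by blast
    then have "z (s p) i mod 2 ^ k = z (s p') i mod 2 ^ k" if "i < r" for i
      using that by (simp add: mod_eq_dvd_iff)
    then have "q (s p) = q (s p')" unfolding q_def by (auto simp: restrict_def)
    then have "p = p'" using s p by metis
    then have "D a = D a'" using eq by simp
    then show "p = p' \<and> a = a'" using \<open>p = p'\<close> unfolding D by (auto simp: fun_eq_iff)
  qed
  moreover have "(\<lambda>(p, a). s p - D a) ` (Q \<times> S0) \<subseteq> X + uminus ` (D ` S)"
    using s(1) by (auto simp del: diff_conv_add_uminus simp: S0_def X1_def intro!: diff_mem)
  moreover have "finite (X + uminus ` (D ` S))" using finX S(2) by (intro finite_set_plus) auto
  ultimately have "card (Q \<times> S0) \<le> card (X + uminus ` (D ` S))"
    by (rule card_inj_on_le)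
  then have "real (card Q * card S0) \<le> \<kappa> ^ (2 * k + 1) * card X"
    using growth[of k] unfolding D_def card_cartesian_product by linarith
  also have "\<dots> \<le> \<kappa> ^ (2 * k + 1) * card S"
    using card_mono[OF S(2) X(1)] \<open>\<kappa> > 0\<close> by (intro mult_left_mono) auto
  also have "\<dots> \<le> \<kappa> ^ (2 * k + 1) * (card F * card S0)"
    using f0(2) \<open>\<kappa> > 0\<close> unfolding S0_def[symmetric] of_nat_mult[symmetric]
    by (intro mult_left_mono of_nat_mono) auto
  finally have "card Q * real (card S0) \<le> (\<kappa> ^ (2 * k + 1) * card F) * card S0"
    by (simp add: mult_ac)
  moreover have "card S0 > 0" using f0(2) S0 unfolding S0_def[symmetric] by (cases "card S0") auto
  ultimately have Q: "card Q \<le> \<kappa> ^ (2 * k + 1) * card F"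
    by (simp only: mult_le_cancel_right_pos of_nat_0_less_iff)
  have "card S \<le> \<kappa> * card X" by (rule X(3))
  also have "\<dots> \<le> \<kappa> * (card F * card X1)"
    using f1(2) \<open>\<kappa> > 0\<close> unfolding X1_def[symmetric] of_nat_mult[symmetric]
    by (intro mult_left_mono of_nat_mono) auto
  also have "\<dots> \<le> \<kappa> * (card F * (card Q * card Y))"
    using y(2) \<open>\<kappa> > 0\<close> unfolding Y_def[symmetric] of_nat_mult[symmetric]
    by (intro mult_left_mono of_nat_mono mult_le_mono) auto
  also have "\<dots> \<le> \<kappa> * (card F * ((\<kappa> ^ (2 * k + 1) * card F) * card Y))"
    unfolding of_nat_mult using Q \<open>\<kappa> > 0\<close> by (intro mult_left_mono mult_right_mono) auto
  also have "\<dots> = real (card F) ^ 2 * \<kappa> ^ (2 * k + 2) * card Y"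
    by (simp add: power2_eq_square mult_ac)
  finally have bound: "card S \<le> real (card F) ^ 2 * \<kappa> ^ (2 * k + 2) * card Y" .
  show ?thesis
  proof (rule that[OF _ _ bound])
    show "Y \<subseteq> S" using X(1) by (auto simp: Y_def X1_def)
    have "f a = f b \<and> z a i mod 2 ^ k = z b i mod 2 ^ k" if "a \<in> Y" "b \<in> Y" "i < r" for a b i
    proof -
      have "q a = q b" using that by (simp add: Y_def)
      then have "q a i = q b i" by simp
      then show ?thesis using that by (simp add: q_def Y_def X1_def)
    qed
    moreover have "f a = f b" if "a \<in> Y" "b \<in> Y" for a b
      using that by (simp add: Y_def X1_def)
    ultimately show "congruent_mod (2 ^ k) Y"
      unfolding congruent_mod_def of_nat_power of_nat_numeral by blast
  qed
qed

text \<open>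
  Conversely, a subset \<open>Y\<close> of a single residue class modulo \<open>2\<^sup>k\<close> has \<open>2\<^sup>k\<^sup>r\<close> disjoint translates,
  one for each class, all of them within \<open>A + \<Theta>\<close> for a finite set \<open>\<Theta>\<close> that depends neither on \<open>Y\<close>
  nor on \<open>k\<close>: the translation vector of a class is taken close to the line through a generic
  vector, which leaves the defect \<open>z y - \<ell> y\<close> from the linear map \<open>\<ell>\<close> bounded.
\<close>

lemma translates_of_residue_class:
  "\<exists>C\<ge>0::real. \<forall>k. \<exists>T. \<forall>L Y. finite Y \<and> Y \<subseteq> {a \<in> A. sup_norm d a < L} \<and> congruent_mod (2 ^ k) Y \<longrightarrow>
     real (card Y * 2 ^ (k * r)) \<le> C * card {a \<in> A. sup_norm d a < L + T}"
proof -
  obtain x where x: "x \<in> Rn d"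
      "\<And>n. (\<Sum>i<r. of_int (n i) * linear_map d u x i) = 0 \<Longrightarrow> \<forall>i<r. n i = (0::int)"
    using generic_direction[where d = d and r = r and u = u] indep_u by blast
  \<comment> \<open>\<open>E\<close> for each of the points \<open>a\<close> and \<open>y\<close>, \<open>1\<close> for the translation vector, and the image under the
    linear map of a vector of norm at most \<open>R\<close>\<close>
  define B where "B = \<lceil>(\<Sum>i<r. \<Sum>j<d. \<bar>u i j\<bar>) * R + 2 * E + 1\<rceil>"
  define \<Theta> where "\<Theta> = (\<lambda>(n, f1, f2). int_comb {..<r} h n + f1 - f2)
      ` (PiE {..<r} (\<lambda>_. {-B..B}) \<times> F \<times> F)"
  have fin\<Theta>: "finite \<Theta>"
    unfolding \<Theta>_def using F(1) by (intro finite_imageI finite_cartesian_product finite_PiE) auto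
  have "\<exists>T. \<forall>L Y. finite Y \<and> Y \<subseteq> {a \<in> A. sup_norm d a < L} \<and> congruent_mod (2 ^ k) Y \<longrightarrow>
       card Y * 2 ^ (k * r) \<le> real (card \<Theta>) * card {a \<in> A. sup_norm d a < L + T}" for k
  proof -
    define M where "M = PiE {..<r} (\<lambda>_. {0..<2 ^ k :: int})"
    have finM: "finite M" unfolding M_def by (intro finite_PiE) auto
    have cardM: "card M = 2 ^ (k * r)"
      unfolding M_def by (simp add: card_PiE power_mult nat_power_eq)
    have "\<exists>\<tau> w. \<forall>i<r. \<bar>\<tau> * linear_map d u x i - of_int (w i)\<bar> < 1 \<and> w i mod 2 ^ k = m i mod 2 ^ k" for m
    proof (rule line_near_all_residue_classes[OF x(2), where k = k and m = m])
      fix t v assume "\<And>i. i < r \<Longrightarrow> \<bar>t * linear_map d u x i - of_int (v i)\<bar> < 1"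
        "\<And>i. i < r \<Longrightarrow> v i mod 2 ^ k = m i mod 2 ^ k"
      then show ?thesis by blast
    qed
    then obtain \<tau> w where \<tau>w: "\<And>m i. i < r \<Longrightarrow> \<bar>\<tau> m * linear_map d u x i - of_int (w m i)\<bar> < 1"
        "\<And>m i. i < r \<Longrightarrow> w m i mod 2 ^ k = m i mod 2 ^ k" by metis
    define T where "T = (\<Sum>m\<in>M. \<bar>\<tau> m\<bar> * sup_norm d x) + R"
    have T: "\<bar>\<tau> m\<bar> * sup_norm d x + R \<le> T" if "m \<in> M" for m
      unfolding T_def using that finM
      by (intro add_right_mono member_le_sum) (auto simp: sup_norm_nonneg)
    have "card Y * 2 ^ (k * r) \<le> card \<Theta> * card {a \<in> A. sup_norm d a < L + T}"
      if Y: "finite Y" "Y \<subseteq> {a \<in> A. sup_norm d a < L}" and "congruent_mod (2 ^ k) Y" for L Y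
    proof -
      have same: "\<forall>a\<in>Y. \<forall>b\<in>Y. f a = f b \<and> (\<forall>i<r. z a i mod 2 ^ k = z b i mod 2 ^ k)"
        using \<open>congruent_mod (2 ^ k) Y\<close> unfolding congruent_mod_def of_nat_power of_nat_numeral .
      define A' where "A' = {a \<in> A. sup_norm d a < L + T}"
      have finA': "finite A'" by (rule finite_subset[OF _ finite_ball[of "L + T"]]) (auto simp: A'_def)
      let ?g = "\<lambda>(y, m). y + int_comb {..<r} h (w m)"
      have "inj_on ?g (Y \<times> M)"
      proof (rule inj_onI, clarify)
        fix y m y' m' assume y: "y \<in> Y" "y' \<in> Y" and m: "m \<in> M" "m' \<in> M"
          and eq: "y + int_comb {..<r} h (w m) = y' + int_comb {..<r} h (w m')"
        have "y - y' = int_comb {..<r} h (\<lambda>i. w m' i - w m i)"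
          unfolding int_comb_diff diff_eq_eq using eq by (metis add.commute diff_add_eq eq_diff_eq)
        moreover have "y - y' = int_comb {..<r} h (\<lambda>i. z y i - z y' i)"
          using Y(2) y same by (intro diff_same_shift) blast+
        ultimately have "int_comb {..<r} h (\<lambda>i. w m' i - w m i) = int_comb {..<r} h (\<lambda>i. z y i - z y' i)"
          by (rule trans[OF sym])
        from int_comb_inject[OF this] have wz: "w m' i - w m i = z y i - z y' i" if "i < r" for i
          using that .
        have "m' i = m i" if "i < r" for i
        proof -
          have "w m' i mod 2 ^ k = w m i mod 2 ^ k"
          proof -
            have "z y i mod 2 ^ k = z y' i mod 2 ^ k" using same y that by blast
            then show ?thesis using wz[OF that] by (simp add: mod_eq_dvd_iff)
          qed
          then have "m' i mod 2 ^ k = m i mod 2 ^ k"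
            unfolding \<tau>w(2)[OF that] .
          moreover have "m i \<in> {0..<2 ^ k}" "m' i \<in> {0..<2 ^ k}"
            using PiE_mem[OF m(1)[unfolded M_def]] PiE_mem[OF m(2)[unfolded M_def]] that by blast+
          ultimately show ?thesis by (simp only: atLeastLessThan_iff mod_pos_pos_trivial)
        qed
        then have "m = m'"
          by (intro PiE_ext[OF m[unfolded M_def]]) (simp only: lessThan_iff)
        then show "y = y' \<and> m = m'" using eq by simp
      qed
      moreover have "?g ` (Y \<times> M) \<subseteq> A' + \<Theta>"
      proof clarify
        fix y m assume y: "y \<in> Y" and m: "m \<in> M"
        have yA: "y \<in> A" using y Y(2) by blast
        define v where "v = (\<lambda>j. \<tau> m * x j)"
        have "y + v \<in> Rn d" unfolding v_def using x(1) in_Rn[OF yA] by (intro Rn_add Rn_scale)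
        then obtain a where a: "a \<in> A" "sup_norm d (a - (y + v)) \<le> R" using dense by blast
        have "sup_norm d v \<le> \<bar>\<tau> m\<bar> * sup_norm d x" unfolding v_def by (rule sup_norm_scale_le)
        then have "sup_norm d a \<le> R + (sup_norm d y + \<bar>\<tau> m\<bar> * sup_norm d x)"
          using sup_norm_triangle[of d y v]
          by (intro sup_norm_sum_le[OF _ a(2), of _ "y + v"]) auto
        then have "a \<in> A'" using a(1) T[OF m] Y(2) y by (force simp: A'_def)
        define n where "n i = z y i + w m i - z a i" for i
        have "\<bar>n i\<bar> \<le> B" if i: "i < r" for i
        proof -
          have "\<bar>linear_map d u (a - (y + v)) i\<bar> \<le> (\<Sum>j<d. \<bar>u i j\<bar>) * sup_norm d (a - (y + v))"
            by (rule linear_map_bound)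
          also have "\<dots> \<le> (\<Sum>i<r. \<Sum>j<d. \<bar>u i j\<bar>) * R"
            using a(2) i sup_norm_nonneg
            by (intro mult_mono member_le_sum) (auto intro!: sum_nonneg member_le_sum)
          finally have "\<bar>linear_map d u (a - (y + v)) i\<bar> \<le> (\<Sum>i<r. \<Sum>j<d. \<bar>u i j\<bar>) * R" .
          moreover have "linear_map d u (a - (y + v)) i
              = linear_map d u a i - (linear_map d u y i + \<tau> m * linear_map d u x i)"
            unfolding v_def linear_map_add linear_map_diff linear_map_scale ..
          ultimately have "real_of_int \<bar>n i\<bar> \<le> (\<Sum>i<r. \<Sum>j<d. \<bar>u i j\<bar>) * R + 2 * E + 1"
            using near_linear[OF a(1) i] near_linear[OF yA i] \<tau>w(1)[OF i, of m]
            unfolding n_def of_int_abs of_int_diff of_int_add by linarith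
          then show ?thesis unfolding B_def by linarith
        qed
        then have "restrict n {..<r} \<in> PiE {..<r} (\<lambda>_. {-B..B})" by (auto simp: abs_le_iff) (smt (verit))
        moreover have "int_comb {..<r} h (restrict n {..<r}) = int_comb {..<r} h n"
          by (rule int_comb_cong) simp
        ultimately have "int_comb {..<r} h n + f y - f a \<in> \<Theta>"
          unfolding \<Theta>_def using f_in[OF yA] f_in[OF a(1)]
          by (intro image_eqI[of _ _ "(restrict n {..<r}, f y, f a)"]) auto
        moreover have "y + int_comb {..<r} h (w m) = a + (int_comb {..<r} h n + f y - f a)"
        proof -
          have "int_comb {..<r} h (z y) = y - f y" "int_comb {..<r} h (z a) = a - f a"
            using decomp[OF yA] decomp[OF a(1)] by (metis add_diff_cancel_right')+
          then show ?thesis unfolding n_def int_comb_diff int_comb_add by simp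
        qed
        ultimately show "y + int_comb {..<r} h (w m) \<in> A' + \<Theta>"
          using \<open>a \<in> A'\<close> by (simp only: set_plus_intro)
      qed
      moreover have "finite (A' + \<Theta>)" using finA' fin\<Theta> by (rule finite_set_plus)
      ultimately have "card (Y \<times> M) \<le> card (A' + \<Theta>)" by (rule card_inj_on_le)
      also have "\<dots> \<le> card (A' \<times> \<Theta>)"
        unfolding set_plus_image using finA' fin\<Theta> by (intro card_image_le) auto
      finally show ?thesis by (simp add: card_cartesian_product cardM A'_def mult.commute)
    qed
    then show ?thesis
      by (intro exI[of _ T]) (simp only: of_nat_mult[symmetric] of_nat_le_iff, blast)
  qed
  then show ?thesis by (intro exI[of _ "real (card \<Theta>)"]) simp
qed

text \<open>The bounds of \<open>popular_residue_class\<close> and \<open>translates_of_residue_class\<close> are compared for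
  \<open>k \<rightarrow> \<infinity>\<close>. For each \<open>k\<close> the side length \<open>L\<close> is chosen so large that the translations, whose length
  depends on \<open>k\<close>, at most double the cube.\<close>

theorem rank_bound:
  fixes \<kappa> :: real
  assumes growth: "\<forall>\<^sub>F L in at_top. real (card {w \<in> minkowski_diff A A. sup_norm d w < 2 * L})
                     \<le> \<kappa> * card {a \<in> A. sup_norm d a < L}"
  shows "2 ^ r \<le> \<kappa> ^ 2"
proof -
  obtain b where b: "b \<in> A" using nonempty by auto
  obtain C :: real where C: "C \<ge> 0" "\<forall>k. \<exists>T. \<forall>L Y. finite Y \<and> Y \<subseteq> {a \<in> A. sup_norm d a < L} \<and>
      congruent_mod (2 ^ k) Y \<longrightarrow> real (card Y * 2 ^ (k * r)) \<le> C * card {a \<in> A. sup_norm d a < L + T}"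
    using translates_of_residue_class by (elim exE conjE)
  \<comment> \<open>three further factors \<open>\<kappa>\<close>: two from the popular class, one from doubling the cube\<close>
  define C' where "C' = C * real (card F) ^ 2 * \<kappa> ^ 3"
  have main: "\<kappa> > 0 \<and> (2 ^ r) ^ k \<le> C' * (\<kappa> ^ 2) ^ k" for k
  proof -
    from C(2) obtain T where T: "\<forall>L Y. finite Y \<and> Y \<subseteq> {a \<in> A. sup_norm d a < L} \<and>
        congruent_mod (2 ^ k) Y \<longrightarrow>
        real (card Y * 2 ^ (k * r)) \<le> C * card {a \<in> A. sup_norm d a < L + T}"
      by (elim allE[of _ k] exE)
    have "\<forall>\<^sub>F L in at_top. real (card {w \<in> minkowski_diff A A. sup_norm d w < 2 * L})
        \<le> \<kappa> * card {a \<in> A. sup_norm d a < L} \<and> L > sup_norm d b \<and> L \<ge> T + sup_norm d b"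
      using growth eventually_gt_at_top eventually_ge_at_top by (intro eventually_conj)
    then obtain L where L: "real (card {w \<in> minkowski_diff A A. sup_norm d w < 2 * L})
        \<le> \<kappa> * card {a \<in> A. sup_norm d a < L}" "L > sup_norm d b" "L \<ge> T + sup_norm d b"
      using eventually_happens'[OF trivial_limit_at_top_linorder] by blast
    define W where "W = {w \<in> minkowski_diff A A. sup_norm d w < 2 * L}"
    define S where "S = {a \<in> A. sup_norm d a < L}"
    have finW: "finite W"
      by (rule finite_subset[OF _ finite_small_diffs[of "2 * L"]]) (auto simp: W_def small_diffs_def)
    have "finite S" by (rule finite_subset[OF _ finite_ball[of L]]) (auto simp: S_def)
    then have S: "S \<subseteq> A" "finite S" "S \<noteq> {}" using b L(2) by (auto simp: S_def)
    then have S0: "card S > 0" by (simp add: card_gt_0_iff)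
    have "S + uminus ` S \<subseteq> W"
    proof
      fix w assume "w \<in> S + uminus ` S"
      then obtain a a' where "a \<in> S" "a' \<in> S" "w = a - a'" by (rule diff_memE)
      then show "w \<in> W" using sup_norm_triangle_diff[of d a a']
        by (force simp: W_def S_def minkowski_diff_def)
    qed
    then have "card (S + uminus ` S) \<le> card W" using finW by (rule card_mono[rotated])
    then have doubling: "card (S + uminus ` S) \<le> \<kappa> * card S"
      using L(1) unfolding W_def S_def by linarith
    have "card W > 0"
    proof -
      have "b - b \<in> W" using b L(2) sup_norm_nonneg[of d b]
        by (auto simp: W_def minkowski_diff_def sup_norm_less_iff intro!: exI[of _ b])
      then show ?thesis using finW by (auto simp: card_gt_0_iff)
    qed
    then have "0 < \<kappa> * card S" using L(1) unfolding W_def[symmetric] S_def[symmetric] by linarith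
    then have "\<kappa> > 0" using S0 by (simp add: zero_less_mult_iff)
    obtain Y where Y: "Y \<subseteq> S" "congruent_mod (2 ^ k) Y"
      and cardY: "card S \<le> real (card F) ^ 2 * \<kappa> ^ (2 * k + 2) * card Y"
      by (rule popular_residue_class[OF S doubling])
    have "card Y * 2 ^ (k * r) \<le> C * card {a \<in> A. sup_norm d a < L + T}"
      using T Y finite_subset[OF Y(1) S(2)] unfolding S_def by blast
    also have "C * card {a \<in> A. sup_norm d a < L + T} \<le> C * (\<kappa> * card S)"
    proof -
      have "card {a \<in> A. sup_norm d a < L + T} \<le> card W"
      proof (rule card_inj_on_le)
        show "inj_on (\<lambda>a. a - b) {a \<in> A. sup_norm d a < L + T}" by (simp add: inj_on_def)
        show "(\<lambda>a. a - b) ` {a \<in> A. sup_norm d a < L + T} \<subseteq> W"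
        proof clarify
          fix a assume a: "a \<in> A" "sup_norm d a < L + T"
          then have "sup_norm d (a - b) < 2 * L"
            using sup_norm_triangle_diff[of d a b] L(3) by linarith
          then show "a - b \<in> W" using a b by (auto simp: W_def minkowski_diff_def)
        qed
      qed (rule finW)
      then have "real (card {a \<in> A. sup_norm d a < L + T}) \<le> \<kappa> * card S"
        using L(1) unfolding W_def[symmetric] S_def[symmetric] by linarith
      then show ?thesis using C(1) by (rule mult_left_mono)
    qed
    finally have YC: "card Y * 2 ^ (k * r) \<le> C * (\<kappa> * card S)" .
    have "2 ^ (k * r) * real (card S) \<le> 2 ^ (k * r) * (real (card F) ^ 2 * \<kappa> ^ (2 * k + 2) * card Y)"
      using cardY by (intro mult_left_mono) auto
    also have "\<dots> = real (card F) ^ 2 * \<kappa> ^ (2 * k + 2) * (card Y * 2 ^ (k * r))"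
      by (simp only: of_nat_mult of_nat_power of_nat_numeral mult_ac)
    also have "\<dots> \<le> real (card F) ^ 2 * \<kappa> ^ (2 * k + 2) * (C * (\<kappa> * card S))"
      using YC \<open>\<kappa> > 0\<close> by (intro mult_left_mono) auto
    also have "\<dots> = (C' * (\<kappa> ^ 2) ^ k) * card S"
      unfolding C'_def power_mult[symmetric] power_add by (simp add: power2_eq_square power3_eq_cube mult_ac)
    finally have "2 ^ (k * r) \<le> C' * (\<kappa> ^ 2) ^ k"
      using S0 by (simp only: mult_le_cancel_right_pos of_nat_0_less_iff)
    then show ?thesis using \<open>\<kappa> > 0\<close> by (simp add: power_mult mult.commute[of k])
  qed
  then have "\<kappa> > 0" by blast
  show ?thesis
  proof (rule ccontr)
    assume "\<not> 2 ^ r \<le> \<kappa> ^ 2"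
    then have "2 ^ r / \<kappa> ^ 2 > 1" using \<open>\<kappa> > 0\<close> by simp
    then obtain k where "C' < (2 ^ r / \<kappa> ^ 2) ^ k" using real_arch_pow by blast
    then have "C' * (\<kappa> ^ 2) ^ k < (2 ^ r) ^ k"
      using \<open>\<kappa> > 0\<close> by (simp add: power_divide pos_less_divide_eq)
    then show False using main[of k] by linarith
  qed
qed

end

section \<open>The cut-and-project set\<close>

lemma continuous_map_coordinate:
  "continuous_map (Euclidean_space n) euclideanreal (\<lambda>x. x i)"
  unfolding continuous_map_Euclidean_space_iff
  by (rule continuous_on_subset[OF continuous_on_product_coordinates]) simp

lemma openin_finitely_many_strips:
  assumes "finite I" and "\<And>i. i \<in> I \<Longrightarrow> continuous_map X euclideanreal (g i)"
  shows "openin X {p \<in> topspace X. \<forall>i\<in>I. \<bar>g i p - c i\<bar> < \<epsilon>}"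
proof -
  have "openin X ((\<Inter>i\<in>I. {p \<in> topspace X. g i p \<in> ball (c i) \<epsilon>}) \<inter> topspace X)"
    using assms by (intro openin_INT openin_continuous_map_preimage) (auto simp flip: open_openin)
  moreover have "(\<Inter>i\<in>I. {p \<in> topspace X. g i p \<in> ball (c i) \<epsilon>}) \<inter> topspace X
      = {p \<in> topspace X. \<forall>i\<in>I. \<bar>g i p - c i\<bar> < \<epsilon>}"
    by (auto simp: dist_real_def abs_minus_commute)
  ultimately show ?thesis by simp
qed

context meyer_coordinates
begin

text \<open>The internal coordinates are the deviations from the linear map, which stay bounded along \<open>A\<close>.
  Taking all \<open>r\<close> of them avoids choosing a complement to the image of the linear map.\<close>

definition lift :: "(nat \<Rightarrow> int) \<Rightarrow> (nat \<Rightarrow> real) \<times> (nat \<Rightarrow> real)" where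
  "lift n = (int_comb {..<r} h n,
     \<lambda>i. if i < r then of_int (n i) - linear_map d u (int_comb {..<r} h n) i else 0)"

lemma lift_diff: "lift (\<lambda>i. n i - n' i) = lift n - lift n'"
  by (simp add: lift_def int_comb_diff linear_map_diff fun_eq_iff)

lemma lift_cong: "(\<And>i. i < r \<Longrightarrow> n i = n' i) \<Longrightarrow> lift n = lift n'"
  using int_comb_cong[of "{..<r}" n n' h] by (auto simp: lift_def)

text \<open>Discreteness holds since \<open>n\<close> is a continuous function of \<open>lift n\<close>, with integer values.\<close>

lemma discrete_subgroup_lift: "discrete_subgroup d r (range lift)"
  unfolding discrete_subgroup_def
proof (intro conjI ballI)
  let ?X = "prod_topology (Euclidean_space d) (Euclidean_space r)"
  show sub: "range lift \<subseteq> Rn d \<times> Rn r"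
    using int_comb_Rn[of "{..<r}" h d] h_Rn by (auto simp: lift_def Rn_iff)
  have zero: "lift (\<lambda>i. 0) = 0" using lift_diff[of "\<lambda>i. 0" "\<lambda>i. 0"] by simp
  then show "0 \<in> range lift" by (metis rangeI)
  have neg: "- lift n = lift (\<lambda>i. 0 - n i)" for n unfolding lift_diff zero by simp
  then show "- p \<in> range lift" if "p \<in> range lift" for p using that by auto
  show "p + q \<in> range lift" if pq: "p \<in> range lift" "q \<in> range lift" for p q
  proof -
    obtain m n where "p = lift m" "q = lift n" using pq by blast
    then have "p + q = lift (\<lambda>i. m i - (0 - n i))" unfolding lift_diff zero by simp
    then show ?thesis by simp
  qed
  show "subtopology ?X (range lift) = discrete_topology (range lift)"
  proof (rule sym, subst discrete_topology_unique, intro conjI ballI)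
    show "topspace (subtopology ?X (range lift)) = range lift" using sub by auto
  next
    fix p assume "p \<in> range lift"
    then obtain n where p: "p = lift n" by blast
    define g where "g i q = snd q i + linear_map d u (fst q) i" for i and q :: "(nat \<Rightarrow> real) \<times> (nat \<Rightarrow> real)"
    have g_lift: "g i (lift m) = of_int (m i)" if "i < r" for i m
      using that by (simp add: g_def lift_def)
    have "continuous_map ?X euclideanreal (g i)" for i
    proof -
      have "continuous_map ?X euclideanreal (\<lambda>q. snd q i)"
        using continuous_map_compose[OF continuous_map_snd continuous_map_coordinate] by (simp add: comp_def)
      moreover have "continuous_map ?X euclideanreal (\<lambda>q. fst q j)" for j
        using continuous_map_compose[OF continuous_map_fst continuous_map_coordinate] by (simp add: comp_def)
      ultimately show ?thesis
        unfolding g_def linear_map_def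
        by (intro continuous_map_add continuous_map_sum continuous_map_real_mult) auto
    qed
    then have "openin ?X {q \<in> topspace ?X. \<forall>i\<in>{..<r}. \<bar>g i q - of_int (n i)\<bar> < 1}"
      by (intro openin_finitely_many_strips) auto
    moreover have "{p} = {q \<in> topspace ?X. \<forall>i\<in>{..<r}. \<bar>g i q - of_int (n i)\<bar> < 1} \<inter> range lift"
    proof (intro subset_antisym subsetI)
      fix q assume q: "q \<in> {q \<in> topspace ?X. \<forall>i\<in>{..<r}. \<bar>g i q - of_int (n i)\<bar> < 1} \<inter> range lift"
      then obtain m where m: "q = lift m" by blast
      have "m i = n i" if "i < r" for i
      proof -
        have "\<bar>g i q - of_int (n i)\<bar> < 1" using q that by blast
        then show ?thesis unfolding m g_lift[OF that] by linarith
      qed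
      then show "q \<in> {p}" unfolding m p using lift_cong[of m n] by simp
    next
      fix q assume "q \<in> {p}"
      then show "q \<in> {q \<in> topspace ?X. \<forall>i\<in>{..<r}. \<bar>g i q - of_int (n i)\<bar> < 1} \<inter> range lift"
        using sub g_lift by (auto simp: p)
    qed
    ultimately show "openin (subtopology ?X (range lift)) {p}"
      unfolding openin_subtopology by blast
  qed
qed

text \<open>The point \<open>a - f a\<close> of the group has coordinates \<open>z a\<close>. Their deviation from the linear map at
  \<open>a - f a\<close>, instead of at \<open>a\<close>, changes by a quantity bounded in terms of \<open>F\<close>.\<close>

proposition covered_by_cut_and_project_set:
  obtains M where "cut_and_project_set d r M" "A \<subseteq> M + F"
proof -
  define B where "B = \<bar>E\<bar> + (\<Sum>i<r. \<Sum>c\<in>F. \<bar>linear_map d u c i\<bar>) + 1"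
  define \<Omega> where "\<Omega> = {y \<in> topspace (Euclidean_space r). \<forall>i\<in>{..<r}. \<bar>y i - 0\<bar> < B}"
  have "B \<ge> 0" unfolding B_def by (auto intro!: add_nonneg_nonneg sum_nonneg)
  have "openin (Euclidean_space r) \<Omega>"
    unfolding \<Omega>_def by (intro openin_finitely_many_strips continuous_map_coordinate) simp
  moreover have "\<forall>y\<in>\<Omega>. sup_norm r y \<le> B"
    using \<open>B \<ge> 0\<close> by (auto simp: \<Omega>_def sup_norm_le_iff intro: less_imp_le)
  ultimately have M: "cut_and_project_set d r (fst ` (range lift \<inter> (Rn d \<times> \<Omega>)))"
    unfolding cut_and_project_set_def using discrete_subgroup_lift by blast
  have "A \<subseteq> fst ` (range lift \<inter> (Rn d \<times> \<Omega>)) + F"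
  proof
    fix a assume a: "a \<in> A"
    have "int_comb {..<r} h (z a) = a - f a" using decomp[OF a] by (metis add_diff_cancel_right')
    then have lift_z: "lift (z a)
        = (a - f a, \<lambda>i. if i < r then of_int (z a i) - linear_map d u (a - f a) i else 0)"
      unfolding lift_def by (simp only:)
    have "snd (lift (z a)) \<in> \<Omega>"
      unfolding \<Omega>_def
    proof (intro CollectI conjI ballI)
      show "snd (lift (z a)) \<in> Rn r" by (simp add: lift_z Rn_iff)
      fix i assume "i \<in> {..<r}"
      then have i: "i < r" by simp
      have "\<bar>linear_map d u (f a) i\<bar> \<le> (\<Sum>c\<in>F. \<bar>linear_map d u c i\<bar>)"
        using F(1) f_in[OF a] by (intro member_le_sum) auto
      also have "\<dots> \<le> (\<Sum>i<r. \<Sum>c\<in>F. \<bar>linear_map d u c i\<bar>)"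
        using i by (intro member_le_sum) (auto intro: sum_nonneg)
      finally have "\<bar>of_int (z a i) - linear_map d u a i + linear_map d u (f a) i\<bar> < B"
        using near_linear[OF a i] unfolding B_def by linarith
      then show "\<bar>snd (lift (z a)) i - 0\<bar> < B" using i by (simp add: lift_z linear_map_diff)
    qed
    moreover have "fst (lift (z a)) \<in> Rn d"
      using in_Rn[OF a] f_in[OF a] F(2) by (auto simp: lift_z intro!: Rn_diff)
    ultimately have "lift (z a) \<in> range lift \<inter> (Rn d \<times> \<Omega>)" by (auto simp: mem_Times_iff)
    then have "a - f a \<in> fst ` (range lift \<inter> (Rn d \<times> \<Omega>))" by (rule rev_image_eqI) (simp add: lift_z)
    from set_plus_intro[OF this f_in[OF a]]
    show "a \<in> fst ` (range lift \<inter> (Rn d \<times> \<Omega>)) + F" by simp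
  qed
  then show ?thesis using M that by blast
qed

end

section \<open>Counting points through uniform densities\<close>

lemma cube_density_finite:
  assumes "L > 0" "finite {b \<in> B. sup_norm d (b - x) < L}"
  shows "cube_density d B L x = ennreal (card {b \<in> B. sup_norm d (b - x) < L} / (2 * L) ^ d)"
  using assms unfolding cube_density_def
  by (simp add: divide_ennreal ennreal_of_nat_eq_real_of_nat)

lemma cube_density_lessD:
  fixes c L :: real
  assumes "L > 0" "cube_density d B L x < ennreal c"
  shows "finite {b \<in> B. sup_norm d (b - x) < L} \<and>
    card {b \<in> B. sup_norm d (b - x) < L} < c * (2 * L) ^ d"
proof -
  have fin: "finite {b \<in> B. sup_norm d (b - x) < L}"
    using assms(2) by (rule contrapos_pp) (simp add: cube_density_def ennreal_top_divide)
  then show ?thesis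
    using assms unfolding cube_density_finite[OF assms(1) fin]
    by (simp add: ennreal_less_iff pos_divide_less_eq)
qed

lemma upper_uniform_density_lessD:
  fixes c :: real
  assumes "upper_uniform_density d B < ennreal c"
  shows "\<forall>\<^sub>F L :: real in at_top. \<forall>x\<in>Rn d. finite {b \<in> B. sup_norm d (b - x) < L} \<and>
           card {b \<in> B. sup_norm d (b - x) < L} < c * (2 * L) ^ d"
proof -
  have "\<forall>\<^sub>F L in at_top. (SUP x\<in>Rn d. cube_density d B L x) < ennreal c"
    using assms unfolding upper_uniform_density_def by (rule Limsup_lessD)
  then show ?thesis
    using eventually_gt_at_top[of "0 :: real"]
  proof eventually_elim
    case (elim L)
    show ?case
    proof
      fix x assume "x \<in> Rn d"
      then have "cube_density d B L x < ennreal c"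
        using elim(1) by (rule le_less_trans[OF SUP_upper])
      then show "finite {b \<in> B. sup_norm d (b - x) < L} \<and>
           card {b \<in> B. sup_norm d (b - x) < L} < c * (2 * L) ^ d"
        by (rule cube_density_lessD[OF elim(2)])
    qed
  qed
qed

lemma lower_uniform_density_greaterD:
  fixes c :: real
  assumes "ennreal c < lower_uniform_density d B" "c \<ge> 0"
  shows "\<forall>\<^sub>F L :: real in at_top. \<forall>x\<in>Rn d. finite {b \<in> B. sup_norm d (b - x) < L} \<longrightarrow>
           c * (2 * L) ^ d < card {b \<in> B. sup_norm d (b - x) < L}"
proof -
  have "\<forall>\<^sub>F L in at_top. ennreal c < (INF x\<in>Rn d. cube_density d B L x)"
    using assms(1) unfolding lower_uniform_density_def by (rule less_LiminfD)
  then show ?thesis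
    using eventually_gt_at_top[of "0 :: real"]
  proof eventually_elim
    case (elim L)
    show ?case
    proof (intro ballI impI)
      fix x assume x: "x \<in> Rn d" "finite {b \<in> B. sup_norm d (b - x) < L}"
      have "ennreal c < cube_density d B L x"
        by (rule less_le_trans[OF elim(1) INF_lower[OF x(1)]])
      then show "c * (2 * L) ^ d < card {b \<in> B. sup_norm d (b - x) < L}"
        using elim(2) assms(2) unfolding cube_density_finite[OF elim(2) x(2)]
        by (simp add: ennreal_less_iff pos_less_divide_eq)
    qed
  qed
qed

text \<open>The factor \<open>2\<^sup>d\<close> arises because the differences of points in a cube fill a cube of twice its side
  length. A constant \<open>c\<close> strictly between the two sides of the assumed
  inequality turns the densities into estimates for all large cubes.\<close>

lemma doubling_of_densities:
  assumes sub: "A \<subseteq> Rn d" and dense: "relatively_dense d A" and "K > 0"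
    and less: "upper_uniform_density d (minkowski_diff A A) < ennreal K * lower_uniform_density d A"
  obtains R where "meyer_set d A R"
    "\<forall>\<^sub>F L in at_top. real (card {w \<in> minkowski_diff A A. sup_norm d w < 2 * L})
       \<le> 2 ^ d * K * card {a \<in> A. sup_norm d a < L}"
proof -
  obtain R where R: "R > 0" "\<forall>x\<in>Rn d. \<exists>a\<in>A. sup_norm d (a - x) \<le> R"
    using dense unfolding relatively_dense_def by blast
  obtain c0 where c0: "upper_uniform_density d (minkowski_diff A A) < c0"
      "c0 < ennreal K * lower_uniform_density d A"
    using dense_order_class.dense[OF less] by blast
  then have "c0 \<noteq> top" by auto
  then obtain c where c: "c \<ge> 0" "c0 = ennreal c" by (cases c0) auto
  have up: "\<forall>\<^sub>F L in at_top. \<forall>x\<in>Rn d. finite {w \<in> minkowski_diff A A. sup_norm d (w - x) < L} \<and>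
      card {w \<in> minkowski_diff A A. sup_norm d (w - x) < L} < c * (2 * L) ^ d"
    using c0(1) unfolding c(2) by (rule upper_uniform_density_lessD)
  have meyer: "meyer_set d A R"
  proof
    show "A \<subseteq> Rn d" "R > 0" by fact+
    show "\<exists>a\<in>A. sup_norm d (a - x) \<le> R" if "x \<in> Rn d" for x using R(2) that by blast
    fix \<rho>
    from eventually_happens'[OF trivial_limit_at_top_linorder eventually_conj[OF up eventually_gt_at_top[of \<rho>]]]
    obtain L where L: "\<forall>x\<in>Rn d. finite {w \<in> minkowski_diff A A. sup_norm d (w - x) < L} \<and>
      card {w \<in> minkowski_diff A A. sup_norm d (w - x) < L} < c * (2 * L) ^ d" "L > \<rho>" by blast
    have "finite {w \<in> minkowski_diff A A. sup_norm d (w - x) \<le> \<rho>} \<and>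
        card {w \<in> minkowski_diff A A. sup_norm d (w - x) \<le> \<rho>} \<le> nat \<lceil>c * (2 * L) ^ d\<rceil>"
      if "x \<in> Rn d" for x
    proof -
      have sub: "{w \<in> minkowski_diff A A. sup_norm d (w - x) \<le> \<rho>}
          \<subseteq> {w \<in> minkowski_diff A A. sup_norm d (w - x) < L}" using L(2) by auto
      have fin: "finite {w \<in> minkowski_diff A A. sup_norm d (w - x) < L}" using L(1) that by blast
      have "card {w \<in> minkowski_diff A A. sup_norm d (w - x) \<le> \<rho>}
          \<le> card {w \<in> minkowski_diff A A. sup_norm d (w - x) < L}" by (rule card_mono[OF fin sub])
      moreover have "card {w \<in> minkowski_diff A A. sup_norm d (w - x) < L} < c * (2 * L) ^ d"
        using L(1) that by blast
      ultimately have "card {w \<in> minkowski_diff A A. sup_norm d (w - x) \<le> \<rho>} \<le> nat \<lceil>c * (2 * L) ^ d\<rceil>"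
        by linarith
      then show ?thesis using finite_subset[OF sub fin] by blast
    qed
    then show "\<exists>N. \<forall>x\<in>Rn d. finite {u \<in> minkowski_diff A A. sup_norm d (u - x) \<le> \<rho>} \<and>
        card {u \<in> minkowski_diff A A. sup_norm d (u - x) \<le> \<rho>} \<le> N" by blast
  qed
  have "ennreal (c / K) < lower_uniform_density d A"
  proof (rule ccontr)
    assume "\<not> ennreal (c / K) < lower_uniform_density d A"
    then have "ennreal K * lower_uniform_density d A \<le> ennreal K * ennreal (c / K)"
      by (intro mult_left_mono) auto
    also have "\<dots> = ennreal c" using \<open>K > 0\<close> c(1) by (simp flip: ennreal_mult)
    finally show False using c0(2) c(2) by simp
  qed
  then have low: "\<forall>\<^sub>F L in at_top. \<forall>x\<in>Rn d. finite {a \<in> A. sup_norm d (a - x) < L} \<longrightarrow>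
      (c / K) * (2 * L) ^ d < card {a \<in> A. sup_norm d (a - x) < L}"
    using c(1) \<open>K > 0\<close> by (intro lower_uniform_density_greaterD) auto
  have "filterlim (\<lambda>L :: real. 2 * L) at_top at_top"
    by (intro filterlim_tendsto_pos_mult_at_top[OF tendsto_const]) (auto simp: filterlim_ident)
  from eventually_compose_filterlim[OF up this] low
  have "\<forall>\<^sub>F L in at_top. real (card {w \<in> minkowski_diff A A. sup_norm d w < 2 * L})
       \<le> 2 ^ d * K * card {a \<in> A. sup_norm d a < L}"
  proof eventually_elim
    case (elim L)
    have "finite {a \<in> A. sup_norm d a < L}"
      by (rule finite_subset[OF _ meyer_set.finite_ball[OF meyer, of L]]) auto
    then have "(c / K) * (2 * L) ^ d < card {a \<in> A. sup_norm d a < L}"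
      using bspec[OF elim(2) Rn_zero] by simp
    then have "2 ^ d * K * ((c / K) * (2 * L) ^ d) \<le> 2 ^ d * K * card {a \<in> A. sup_norm d a < L}"
      using \<open>K > 0\<close> by (intro mult_left_mono) auto
    moreover have "2 ^ d * K * ((c / K) * (2 * L) ^ d) = c * (2 * (2 * L)) ^ d"
      unfolding power_mult_distrib[of 2 "2 * L"] using \<open>K > 0\<close> by simp
    moreover have "card {w \<in> minkowski_diff A A. sup_norm d w < 2 * L} < c * (2 * (2 * L)) ^ d"
      using bspec[OF elim(1) Rn_zero] by simp
    ultimately show ?case by linarith
  qed
  then show ?thesis using meyer that by blast
qed

theorem theorem1p3:
  shows "\<exists>C::real. C > 0 \<and>
    (\<forall>(d::nat) (K::real) (A :: (nat \<Rightarrow> real) set).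
       d \<ge> 1 \<and> K \<ge> 2 \<and> A \<subseteq> Rn d \<and> relatively_dense d A \<and>
       upper_uniform_density d (minkowski_diff A A) < ennreal K * lower_uniform_density d A \<longrightarrow>
       (\<exists>(e::nat) M F.
          cut_and_project_set d e M \<and> real e \<le> C * (real d + ln K) ^ 7 \<and>
          F \<subseteq> Rn d \<and> finite F \<and> A \<subseteq> M + F))"
proof (intro exI[of _ "3::real"] conjI allI impI)
  fix d :: nat and K :: real and A :: "(nat \<Rightarrow> real) set"
  assume "d \<ge> 1 \<and> K \<ge> 2 \<and> A \<subseteq> Rn d \<and> relatively_dense d A \<and>
       upper_uniform_density d (minkowski_diff A A) < ennreal K * lower_uniform_density d A"
  then have d: "d \<ge> 1" and K: "K \<ge> 2" and A: "A \<subseteq> Rn d" "relatively_dense d A"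
      "upper_uniform_density d (minkowski_diff A A) < ennreal K * lower_uniform_density d A"
    by blast+
  from K have "K > 0" by simp
  obtain R where "meyer_set d A R"
    and growth: "\<forall>\<^sub>F L in at_top. real (card {w \<in> minkowski_diff A A. sup_norm d w < 2 * L})
       \<le> 2 ^ d * K * card {a \<in> A. sup_norm d a < L}"
    by (rule doubling_of_densities[OF A(1,2) \<open>K > 0\<close> A(3)])
  then interpret meyer_set d A R by blast
  obtain r h F z f u E where "meyer_coordinates d A R r h F z f u E"
    by (rule linear_coordinates)
  then interpret meyer_coordinates d A R r h F z f u E .
  obtain M where M: "cut_and_project_set d r M" "A \<subseteq> M + F"
    by (rule covered_by_cut_and_project_set)
  have "real r * ln 2 = ln (2 ^ r)" by (simp add: ln_realpow)
  also have "\<dots> \<le> ln ((2 ^ d * K) ^ 2)"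
    using rank_bound[OF growth] \<open>K > 0\<close> by (subst ln_le_cancel_iff) auto
  also have "\<dots> = 2 * (real d * ln 2 + ln K)"
    using \<open>K > 0\<close> by (simp add: ln_realpow ln_mult)
  finally have "real r * ln 2 \<le> 2 * real d * ln 2 + 2 * ln K" by simp
  \<comment> \<open>\<open>2 / ln 2 \<le> 3\<close>\<close>
  moreover have "2 * ln K \<le> 3 * ln K * ln 2"
    using mult_left_mono[OF ln2_ge_two_thirds, of "3 * ln K"] K by simp
  ultimately have "real r * ln 2 \<le> (2 * real d + 3 * ln K) * ln 2" by (simp add: algebra_simps)
  then have "real r \<le> 2 * real d + 3 * ln K" by simp
  also have "\<dots> \<le> 3 * (real d + ln K)" by simp
  also have "\<dots> \<le> 3 * (real d + ln K) ^ 7"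
  proof -
    have "1 \<le> real d" "0 \<le> ln K" using d K by auto
    then have "1 \<le> real d + ln K" by linarith
    then show ?thesis using self_le_power[of "real d + ln K" 7] by simp
  qed
  finally have "real r \<le> 3 * (real d + ln K) ^ 7" .
  then show "\<exists>(e::nat) M F. cut_and_project_set d e M \<and> real e \<le> 3 * (real d + ln K) ^ 7 \<and>
      F \<subseteq> Rn d \<and> finite F \<and> A \<subseteq> M + F"
    using M F by blast
qed simp

end
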